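(* Let $(X,d)$ be a nonempty complete, doubling, uniformly perfect metric space without isolated points. Then there exist a tree with a reference point $(T,\pi,\phi)$ and a partition $K$ of $(X,d)$ parametrized by $(T,\pi,\phi)$ such that $d$ satisfies the basic framework with respect to $K$.
   Context: $B(x,r)$ denotes an open ball. A metric space $(X,d)$ is doubling if there exists $N\in\mathbb{N}$ such that for any $x\in X$, $r>0$ there exist $x_1,\dots,x_N\in X$ with $B(x,2r)\subset\bigcup_{i=1}^NB(x_i,r)$. It is uniformly perfect if there exists $\gamma>1$ such that $B(x,\gamma r)\setminus B(x,r)\ne\emptyset$ whenever $B(x,r)\ne X$ ($x\in X$, $r>0$). Tree with a reference point: Let $T$ be a countable (nonempty) set and $\pi:T\to T$ a map such that (H1) $F_\pi=\{w\in T\mid \pi^n(w)=w\text{ for some }n\ge1\}$ has at most one element; (H2) for any $w,v\in T$ there exist $n,m\ge0$ with $\pi^n(w)=\pi^m(v)$. Let $\phi$ be the element of $F_\pi$ if $F_\pi\neq\emptyset$, and otherwise let $\phi\in T$ be any fixed element. The triplet $(T,\pi,\phi)$ is called a tree with a reference point. For $w,v\in T$ let $b(w,v)=\min\{n\ge0\mid \pi^n(w)=\pi^m(v)\text{ for some }m\ge0\}$, let $[w]=b(w,\phi)-b(\phi,w)$, and $(T)_k=\{w\in T\mid[w]=k\}$ for $k\in\mathbb{Z}$. Partition: Let $(Y,\rho)$ be a ($\sigma$-compact) metric space without isolated points and let $\mathcal{C}(Y,\rho)$ be the set of all nonempty compact subsets of $Y$ that are not single points. A map $K:T\to\mathcal{C}(Y,\rho)$,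 $w\mapsto K_w$, is a partition of $(Y,\rho)$ parametrized by $(T,\pi,\phi)$ if (P1) $\bigcup_{w\in(T)_0}K_w=Y$ and for any $w\in T$, $\bigcup_{v\in\pi^{-1}(w)\setminus\{w\}}K_v=K_w$; (P2) for any non-constant sequence $(w_k)_{k\in\mathbb{Z}}$ in $T$ with $\pi(w_{k+1})=w_k$ for all $k\in\mathbb{Z}$, $\bigcap_{k\in\mathbb{Z}}K_{w_k}$ is a single point. Notation for a partition $K$ of $(Y,\rho)$: $g_\rho(w)=\mathrm{diam}(K_w,\rho)$. For $s\in(0,\infty)$: if $F_\pi\neq\emptyset$ and $s>g_\rho(\phi)$, then $\Lambda^\rho_s=\emptyset$; if $F_\pi\ne\emptyset$ and $s=g_\rho(\phi)$, then $\Lambda^\rho_s=\{\phi\}$; otherwise $\Lambda^\rho_s=\{w\in T\mid g_\rho(w)\le s<g_\rho(\pi(w))\}$. Let $E^\rho_s=\{(w,v)\in\Lambda^\rho_s\times\Lambda^\rho_s\mid w\neq v,\ K_w\cap K_v\neq\emptyset\}$, and let $l^\rho_s$ be the graph distance of $(\Lambda^\rho_s,E^\rho_s)$ ($\infty$ between different components). For $M\ge1$ and $x,y\in Y$, $$\delta^\rho_M(x,y)=\inf\{s>0\mid\text{there exist }w,v\in\Lambda^\rho_s\text{ with }x\in K_w,\ y\in K_v,\ l^\rho_s(w,v)\le M\}.$$ Basic framework: Assume $\sup_{w\in T}\#\pi^{-1}(w)<\infty$ and let $K$ be a partition of $(Y,\rho)$ such that for any $w\in T$, $K_w\setminus\bigcup_{v\in(T)_{[w]},\,v\ne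 w}K_v\neq\emptyset$, and there exists an open set $U_w\supset K_w$ with $\#\{v\in(T)_{[w]}\mid U_w\cap K_v\ne\emptyset\}<\infty$. The metric $\rho$ satisfies the basic framework with respect to $K$ if (all the preceding requirements hold and) (B1) there exist $M\ge1$, $\eta_1>0$ such that $\eta_1^{-1}\delta^\rho_M(x,y)\le\rho(x,y)\le\eta_1\delta^\rho_M(x,y)$ for any $x,y\in Y$; (B2) there exists $\eta_2>0$ such that for any $w\in T$, $\{y\in Y\mid\delta^\rho_1(x_w,y)\le\eta_2g_\rho(\pi(w))\}\subset K_w$ for some $x_w\in K_w$; (B3) $\sup_{s\in(0,\infty),\,w\in\Lambda^\rho_s}\#\{v\in\Lambda^\rho_s\mid l^\rho_s(w,v)\le1\}<\infty$; (B4) there exist $\eta_3>0$ and $r\in(0,1)$ such that $\eta_3^{-1}r^{[w]}\le g_\rho(w)\le\eta_3r^{[w]}$ for any $w\in T$. *)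

theory Defs
  imports "HOL-Analysis.Analysis" "HOL-Library.Extended_Nat" "HOL-Library.Extended_Real"
begin

text \<open>
  A metric space \<open>(X, d)\<close> is a type \<open>'a\<close> of class \<^class>\<open>metric_space\<close> with metric \<open>dist\<close>. The
  balls below are therefore balls of the whole space, and a metric space is automatically nonempty.
\<close>

definition doubling_space :: "'a::metric_space itself \<Rightarrow> bool" where
  "doubling_space _ \<longleftrightarrow>
     (\<exists>N::nat. \<forall>(x::'a) r. 0 < r \<longrightarrow>
        (\<exists>c::nat \<Rightarrow> 'a. ball x (2 * r) \<subseteq> (\<Union>i\<in>{1..N}. ball (c i) r)))"

definition uniformly_perfect_space :: "'a::metric_space itself \<Rightarrow> bool" where
  "uniformly_perfect_space _ \<longleftrightarrow>
     (\<exists>\<gamma>>1. \<forall>(x::'a) r. 0 < r \<longrightarrow> ball x r \<noteq> UNIV \<longrightarrow> ball x (\<gamma> * r) - ball x r \<noteq> {})"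

definition no_isolated_points :: "'a::topological_space itself \<Rightarrow> bool" where
  "no_isolated_points _ \<longleftrightarrow> (\<forall>x::'a. \<not> x isolated_in UNIV)"

definition sigma_compact_space :: "'a::topological_space itself \<Rightarrow> bool" where
  "sigma_compact_space _ \<longleftrightarrow>
     (\<exists>C::nat \<Rightarrow> 'a set. (\<forall>n. compact (C n)) \<and> (\<Union>n. C n) = UNIV)"

text \<open>
  The vertex set \<open>T\<close> is a carrier set; \<open>\<pi>\<close> is only relevant on \<open>T\<close>, which it maps into itself.
\<close>

definition periodic_points :: "'t set \<Rightarrow> ('t \<Rightarrow> 't) \<Rightarrow> 't set" where
  "periodic_points T \<pi> = {w \<in> T. \<exists>n\<ge>1. (\<pi> ^^ n) w = w}"

definition tree_with_reference_point :: "'t set \<Rightarrow> ('t \<Rightarrow> 't) \<Rightarrow> 't \<Rightarrow> bool" where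
  "tree_with_reference_point T \<pi> \<phi> \<longleftrightarrow>
     countable T \<and> T \<noteq> {} \<and> \<pi> \<in> T \<rightarrow> T \<and>
     (\<forall>w\<in>periodic_points T \<pi>. \<forall>v\<in>periodic_points T \<pi>. w = v) \<and>
     (\<forall>w\<in>T. \<forall>v\<in>T. \<exists>n m. (\<pi> ^^ n) w = (\<pi> ^^ m) v) \<and>
     \<phi> \<in> T \<and> (periodic_points T \<pi> \<noteq> {} \<longrightarrow> \<phi> \<in> periodic_points T \<pi>)"

definition confluence_height :: "('t \<Rightarrow> 't) \<Rightarrow> 't \<Rightarrow> 't \<Rightarrow> nat" where
  "confluence_height \<pi> w v = (LEAST n. \<exists>m. (\<pi> ^^ n) w = (\<pi> ^^ m) v)"

definition level :: "('t \<Rightarrow> 't) \<Rightarrow> 't \<Rightarrow> 't \<Rightarrow> int" where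
  "level \<pi> \<phi> w = int (confluence_height \<pi> w \<phi>) - int (confluence_height \<pi> \<phi> w)"

definition level_set :: "'t set \<Rightarrow> ('t \<Rightarrow> 't) \<Rightarrow> 't \<Rightarrow> int \<Rightarrow> 't set" where
  "level_set T \<pi> \<phi> k = {w \<in> T. level \<pi> \<phi> w = k}"

definition is_partition ::
  "'t set \<Rightarrow> ('t \<Rightarrow> 't) \<Rightarrow> 't \<Rightarrow> ('t \<Rightarrow> 'a::metric_space set) \<Rightarrow> bool" where
  "is_partition T \<pi> \<phi> K \<longleftrightarrow>
     sigma_compact_space TYPE('a) \<and> no_isolated_points TYPE('a) \<and>
     (\<forall>w\<in>T. compact (K w) \<and> K w \<noteq> {} \<and> (\<nexists>x. K w = {x})) \<and>
     (\<Union>w\<in>level_set T \<pi> \<phi> 0. K w) = UNIV \<and>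
     (\<forall>w\<in>T. (\<Union>v\<in>{v \<in> T. \<pi> v = w} - {w}. K v) = K w) \<and>
     (\<forall>w::int \<Rightarrow> 't. (\<forall>k. w k \<in> T) \<longrightarrow> (\<nexists>c. \<forall>k. w k = c) \<longrightarrow> (\<forall>k. \<pi> (w (k + 1)) = w k) \<longrightarrow>
        (\<exists>x. (\<Inter>k. K (w k)) = {x}))"

text \<open>The scale \<open>\<Lambda>\<^sub>s\<close>, where \<open>g\<^sub>\<rho>(w)\<close> is \<open>diameter (K w)\<close>.\<close>

definition scale ::
  "'t set \<Rightarrow> ('t \<Rightarrow> 't) \<Rightarrow> 't \<Rightarrow> ('t \<Rightarrow> 'a::metric_space set) \<Rightarrow> real \<Rightarrow> 't set" where
  "scale T \<pi> \<phi> K s =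
     (if periodic_points T \<pi> \<noteq> {} \<and> s > diameter (K \<phi>) then {}
      else if periodic_points T \<pi> \<noteq> {} \<and> s = diameter (K \<phi>) then {\<phi>}
      else {w \<in> T. diameter (K w) \<le> s \<and> s < diameter (K (\<pi> w))})"

definition scale_edges ::
  "'t set \<Rightarrow> ('t \<Rightarrow> 't) \<Rightarrow> 't \<Rightarrow> ('t \<Rightarrow> 'a::metric_space set) \<Rightarrow> real \<Rightarrow> ('t \<times> 't) set" where
  "scale_edges T \<pi> \<phi> K s =
     {(w, v) \<in> scale T \<pi> \<phi> K s \<times> scale T \<pi> \<phi> K s. w \<noteq> v \<and> K w \<inter> K v \<noteq> {}}"

text \<open>
  The graph distance is the least length of a walk; it is \<open>\<infinity>\<close>, the infimum of the empty set
  in \<^typ>\<open>enat\<close>, between different components.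
\<close>

definition graph_dist :: "('t \<times> 't) set \<Rightarrow> 't \<Rightarrow> 't \<Rightarrow> enat" where
  "graph_dist E w v = (INF n\<in>{n. (w, v) \<in> E ^^ n}. enat n)"

definition scale_dist ::
  "'t set \<Rightarrow> ('t \<Rightarrow> 't) \<Rightarrow> 't \<Rightarrow> ('t \<Rightarrow> 'a::metric_space set) \<Rightarrow> real \<Rightarrow> 't \<Rightarrow> 't \<Rightarrow> enat" where
  "scale_dist T \<pi> \<phi> K s = graph_dist (scale_edges T \<pi> \<phi> K s)"

text \<open>
  The infimum is taken in the extended reals, so that the infimum of the empty set is \<open>\<infinity>\<close>.
\<close>

definition delta ::
  "'t set \<Rightarrow> ('t \<Rightarrow> 't) \<Rightarrow> 't \<Rightarrow> ('t \<Rightarrow> 'a::metric_space set) \<Rightarrow> nat \<Rightarrow> 'a \<Rightarrow> 'a \<Rightarrow> ereal" where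
  "delta T \<pi> \<phi> K M x y =
     (INF s\<in>{s. 0 < s \<and> (\<exists>w\<in>scale T \<pi> \<phi> K s. \<exists>v\<in>scale T \<pi> \<phi> K s.
                 x \<in> K w \<and> y \<in> K v \<and> scale_dist T \<pi> \<phi> K s w v \<le> enat M)}. ereal s)"

text \<open>
  The supremum of the cardinalities of a family of sets is finite. \<^const>\<open>card\<close> is \<open>0\<close> on infinite
  sets, so finiteness has to be required separately.
\<close>

definition uniformly_finite :: "'b set set \<Rightarrow> bool" where
  "uniformly_finite \<A> \<longleftrightarrow> (\<exists>N. \<forall>A\<in>\<A>. finite A \<and> card A \<le> N)"

definition basic_framework ::
  "'t set \<Rightarrow> ('t \<Rightarrow> 't) \<Rightarrow> 't \<Rightarrow> ('t \<Rightarrow> 'a::metric_space set) \<Rightarrow> bool" where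
  "basic_framework T \<pi> \<phi> K \<longleftrightarrow>
     uniformly_finite {{v \<in> T. \<pi> v = w} | w. w \<in> T} \<and>
     (\<forall>w\<in>T. K w - (\<Union>v\<in>level_set T \<pi> \<phi> (level \<pi> \<phi> w) - {w}. K v) \<noteq> {}) \<and>
     (\<forall>w\<in>T. \<exists>U. open U \<and> K w \<subseteq> U \<and>
        finite {v \<in> level_set T \<pi> \<phi> (level \<pi> \<phi> w). U \<inter> K v \<noteq> {}}) \<and>
     (\<exists>M\<ge>1. \<exists>\<eta>\<^sub>1>0. \<forall>x y.
        ereal (inverse \<eta>\<^sub>1) * delta T \<pi> \<phi> K M x y \<le> ereal (dist x y) \<and>
        ereal (dist x y) \<le> ereal \<eta>\<^sub>1 * delta T \<pi> \<phi> K M x y) \<and>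
     (\<exists>\<eta>\<^sub>2>0. \<forall>w\<in>T. \<exists>x\<in>K w.
        {y. delta T \<pi> \<phi> K 1 x y \<le> ereal (\<eta>\<^sub>2 * diameter (K (\<pi> w)))} \<subseteq> K w) \<and>
     uniformly_finite {{v \<in> scale T \<pi> \<phi> K s. scale_dist T \<pi> \<phi> K s w v \<le> 1} | s w.
        0 < s \<and> w \<in> scale T \<pi> \<phi> K s} \<and>
     (\<exists>\<eta>\<^sub>3>0. \<exists>r. 0 < r \<and> r < 1 \<and> (\<forall>w\<in>T.
        inverse \<eta>\<^sub>3 * r powi level \<pi> \<phi> w \<le> diameter (K w) \<and>
        diameter (K w) \<le> \<eta>\<^sub>3 * r powi level \<pi> \<phi> w))"

end

theory Submission
  imports Defs
begin

text \<open>
  The vertices of level \<open>k\<close> are the points of a maximal \<open>a r\<^sup>k\<close>-separated set, for all \<open>k\<close> if the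
  space is unbounded and for \<open>k \<ge> 0\<close> with a single vertex of level \<open>0\<close> otherwise, and \<open>K\<^sub>w\<close> is the closure
  of the set of descendants of \<open>w\<close>. With nearest parents, two nearby points could be separated by
  cells of every intermediate scale that do not touch, so the lower bound of the metric by \<open>\<delta>\<^sub>M\<close>
  would fail. The parents are therefore chosen such that any two adjacent vertices (of
  distance at most \<open>A a r\<^sup>k\<close>) have a pair of adjacent children. Iterating this, adjacent vertices
  have intersecting cells, and any two points of distance at most \<open>a r\<^sup>k\<close> are joined by a chain of
  four cells of level \<open>k\<close>. Such a choice is possible for small \<open>r\<close>: uniform perfectness yields
  disjoint annuli about \<open>w\<close>, one for each of the boundedly many neighbours \<open>v\<close> of \<open>w\<close>, and each
  annulus contains an adjacent pair of vertices of level \<open>k + 1\<close>, one of which is handed over to \<open>v\<close>.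
  Near the centre of \<open>w\<close> nothing is handed over, so that \<open>K\<^sub>w\<close> still contains a ball about \<open>w\<close> which
  is disjoint from the other cells of its level.
\<close>

section \<open>Separated sets in doubling spaces\<close>

text \<open>A finite infimum in \<open>enat\<close> is attained, so the bound is realised by an
  actual walk; an empty set of lengths would give \<infinity>.\<close>

lemma graph_dist_le_iff: "graph_dist E w v \<le> enat M \<longleftrightarrow> (\<exists>n\<le>M. (w, v) \<in> E ^^ n)"
proof
  let ?A = "enat ` {n. (w, v) \<in> E ^^ n}"
  assume le: "graph_dist E w v \<le> enat M"
  then have "?A \<noteq> {}"
    unfolding graph_dist_def Inf_enat_def by (auto split: if_splits)
  then have "Inf ?A = (LEAST x. x \<in> ?A)"
    by (simp add: Inf_enat_def del: image_is_empty)
  moreover have "(LEAST x. x \<in> ?A) \<in> ?A"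
    using \<open>?A \<noteq> {}\<close> by (metis LeastI_ex ex_in_conv)
  ultimately have "graph_dist E w v \<in> ?A"
    by (simp add: graph_dist_def)
  then show "\<exists>n\<le>M. (w, v) \<in> E ^^ n"
    using le by auto
next
  assume "\<exists>n\<le>M. (w, v) \<in> E ^^ n"
  then obtain n where "n \<le> M" "(w, v) \<in> E ^^ n" by blast
  then have "graph_dist E w v \<le> enat n"
    unfolding graph_dist_def by (intro INF_lower) auto
  then show "graph_dist E w v \<le> enat M"
    using \<open>n \<le> M\<close> by (meson enat_ord_simps(1) order_trans)
qed

lemma diameter_leI:
  fixes S :: "'a::metric_space set"
  assumes "S \<noteq> {}" "\<And>x y. x \<in> S \<Longrightarrow> y \<in> S \<Longrightarrow> dist x y \<le> d"
  shows "diameter S \<le> d"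
  using assms by (auto simp: diameter_def intro!: cSUP_least)

text \<open>Each halving of the radius multiplies the number of balls by at most \<open>N\<close>,
  uniformly in the centre and the scale.\<close>

lemma doubling_iterate:
  assumes N: "\<forall>(x::'a::metric_space) r. 0 < r \<longrightarrow>
      (\<exists>c::nat \<Rightarrow> 'a. ball x (2 * r) \<subseteq> (\<Union>i\<in>{1..N}. ball (c i) r))"
    and "0 < r"
  shows "\<exists>C. finite C \<and> card C \<le> N ^ m \<and> ball (x::'a) (2 ^ m * r) \<subseteq> (\<Union>c\<in>C. ball c r)"
  using \<open>0 < r\<close>
proof (induction m arbitrary: x)
  case 0
  then show ?case by (intro exI[of _ "{x}"]) auto
next
  case (Suc m)
  have "0 < 2 ^ m * r"
    using Suc.prems by simp
  from N[rule_format, OF this, of x]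
  obtain c where c: "ball x (2 * (2 ^ m * r)) \<subseteq> (\<Union>i\<in>{1..N}. ball (c i) (2 ^ m * r))"
    by (rule exE)
  obtain C where C: "\<And>y::'a. finite (C y)" "\<And>y. card (C y) \<le> N ^ m"
      "\<And>y. ball y (2 ^ m * r) \<subseteq> (\<Union>c\<in>C y. ball c r)"
    using Suc.IH[OF Suc.prems] by metis
  let ?D = "\<Union>i\<in>{1..N}. C (c i)"
  have "card ?D \<le> (\<Sum>i\<in>{1..N}. card (C (c i)))"
    by (rule card_UN_le) auto
  also have "\<dots> \<le> (\<Sum>i\<in>{1..N}. N ^ m)"
    by (intro sum_mono C)
  finally have "card ?D \<le> N ^ Suc m" by simp
  moreover have "ball x (2 ^ Suc m * r) \<subseteq> (\<Union>c\<in>?D. ball c r)"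
  proof -
    have "ball x (2 ^ Suc m * r) \<subseteq> (\<Union>i\<in>{1..N}. ball (c i) (2 ^ m * r))"
      using c by (simp only: power_Suc mult.assoc)
    also have "\<dots> \<subseteq> (\<Union>i\<in>{1..N}. \<Union>c\<in>C (c i). ball c r)"
      by (intro UN_mono subset_refl C)
    also have "\<dots> = (\<Union>c\<in>?D. ball c r)"
      by blast
    finally show ?thesis .
  qed
  moreover have "finite ?D"
    using C(1) by simp
  ultimately show ?case
    by (intro exI[of _ ?D] conjI)
qed

text \<open>Iterated doubling covers \<open>S\<close> by boundedly many balls of radius
  \<open>s/2\<close>, each of which contains at most one point of an \<open>s\<close>-separated set.
  The bound depends on the ratio \<open>L\<close>, but not on centre or scale.\<close>

lemma doubling_separated_card:
  assumes "doubling_space TYPE('a::metric_space)"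
  shows "\<exists>N. \<forall>(x::'a) s S. 0 < s \<longrightarrow> S \<subseteq> cball x (L * s) \<longrightarrow>
           (\<forall>y\<in>S. \<forall>z\<in>S. y \<noteq> z \<longrightarrow> s \<le> dist y z) \<longrightarrow> finite S \<and> card S \<le> N"
proof -
  obtain N where N: "\<forall>(x::'a) r. 0 < r \<longrightarrow>
      (\<exists>c::nat \<Rightarrow> 'a. ball x (2 * r) \<subseteq> (\<Union>i\<in>{1..N}. ball (c i) r))"
    using assms unfolding doubling_space_def by (rule exE)
  obtain m where m: "2 * L < 2 ^ m"
    using real_arch_pow[of 2 "2 * L"] by auto
  have "finite S \<and> card S \<le> N ^ m"
    if s: "0 < s" and S: "S \<subseteq> cball x (L * s)" and sep: "\<forall>y\<in>S. \<forall>z\<in>S. y \<noteq> z \<longrightarrow> s \<le> dist y z"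
    for x :: 'a and s S
  proof -
    obtain C where C: "finite C" "card C \<le> N ^ m" "ball x (2 ^ m * (s/2)) \<subseteq> (\<Union>c\<in>C. ball c (s/2))"
      using doubling_iterate[OF N half_gt_zero[OF s], of m x] by blast
    have "L * s < 2 ^ m * (s/2)"
      using m s by (simp add: field_simps)
    then have "\<exists>c\<in>C. y \<in> ball c (s/2)" if "y \<in> S" for y
    proof -
      have "dist x y \<le> L * s"
        using that S by auto
      then have "y \<in> ball x (2 ^ m * (s/2))"
        using \<open>L * s < _\<close> by simp
      then show ?thesis
        using C(3) by blast
    qed
    then obtain f where f: "\<And>y. y \<in> S \<Longrightarrow> f y \<in> C \<and> dist (f y) y < s/2"
      by (metis mem_ball)
    have "inj_on f S"
    proof (rule inj_onI, rule ccontr)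
      fix y z assume "y \<in> S" "z \<in> S" "f y = f z" "y \<noteq> z"
      then have "dist y z < s"
        using f[of y] f[of z] dist_triangle_half_r[of "f y" y s z] by simp
      then show False
        using sep \<open>y \<in> S\<close> \<open>z \<in> S\<close> \<open>y \<noteq> z\<close> by fastforce
    qed
    moreover have "f ` S \<subseteq> C"
      using f by auto
    ultimately show ?thesis
      using C(1,2) by (meson card_inj_on_le inj_on_finite le_trans)
  qed
  then show ?thesis
    by (intro exI[of _ "N ^ m"] allI impI)
qed

lemma compact_cball_doubling:
  assumes "complete (UNIV :: 'a::metric_space set)" "doubling_space TYPE('a)"
  shows "compact (cball (x::'a) R)"
proof -
  obtain N where N: "\<forall>(x::'a) r. 0 < r \<longrightarrow>
      (\<exists>c::nat \<Rightarrow> 'a. ball x (2 * r) \<subseteq> (\<Union>i\<in>{1..N}. ball (c i) r))"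
    using assms(2) unfolding doubling_space_def by (rule exE)
  have "\<exists>C. finite C \<and> cball x R \<subseteq> (\<Union>c\<in>C. ball c e)" if "e > 0" for e
  proof -
    obtain m where "R / e < 2 ^ m"
      using real_arch_pow[of 2 "R / e"] by auto
    then have "cball x R \<subseteq> ball x (2 ^ m * e)"
      using \<open>e > 0\<close> by (auto simp: field_simps)
    then show ?thesis
      using doubling_iterate[OF N \<open>e > 0\<close>, of m x] by blast
  qed
  moreover have "complete (cball x R)"
    using complete_Int_closed[OF assms(1) closed_cball] by simp
  ultimately show ?thesis
    by (auto simp: compact_eq_totally_bounded)
qed

text \<open>By Zorn's lemma; maximality gives the covering property. The prescribed point
  \<open>x0\<close> lets the nets of all scales share a point.\<close>

lemma maximal_separated_set:
  fixes x0 :: "'a::metric_space"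
  assumes "0 < s"
  shows "\<exists>N. x0 \<in> N \<and> (\<forall>y\<in>N. \<forall>z\<in>N. y \<noteq> z \<longrightarrow> s \<le> dist y z) \<and> (\<forall>x. \<exists>y\<in>N. dist x y < s)"
proof -
  define F where "F = {N. x0 \<in> N \<and> (\<forall>y\<in>N. \<forall>z\<in>N. y \<noteq> z \<longrightarrow> s \<le> dist y z)}"
  have "{x0} \<in> F" by (simp add: F_def)
  moreover have "\<Union>C \<in> F" if "C \<noteq> {}" "subset.chain F C" for C
  proof -
    have "s \<le> dist y z" if "y \<in> A" "A \<in> C" "z \<in> B" "B \<in> C" "y \<noteq> z" for y z A B
    proof -
      have "A \<subseteq> B \<or> B \<subseteq> A" "A \<in> F" "B \<in> F"
        using \<open>subset.chain F C\<close> that by (auto simp: subset.chain_def)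
      then show ?thesis
        using that by (auto simp: F_def)
    qed
    moreover have "x0 \<in> \<Union>C"
      using that by (auto simp: subset.chain_def F_def)
    ultimately show ?thesis by (auto simp: F_def)
  qed
  ultimately obtain N where N: "N \<in> F" "\<And>X. X \<in> F \<Longrightarrow> N \<subseteq> X \<Longrightarrow> X = N"
    using subset_Zorn_nonempty[of F] by blast
  have "\<exists>y\<in>N. dist x y < s" for x
  proof (rule ccontr)
    assume "\<not> ?thesis"
    then have far: "\<And>y. y \<in> N \<Longrightarrow> s \<le> dist x y" by (meson not_le)
    then have "insert x N \<in> F"
      using N(1) by (auto simp: F_def dist_commute)
    then have "x \<in> N"
      using N(2) by blast
    then show False
      using far[of x] assms by simp
  qed
  then show ?thesis
    using N(1) by (auto simp: F_def)
qed

section \<open>Cells of a tree of separated sets\<close>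

text \<open>Interface between the construction of the tree and the verification of the framework.
  The flag \<open>rooted\<close> unites bounded spaces, with levels from \<open>0\<close> on, and
  unbounded ones, with all integers as levels. \<open>perfect\<close> is restricted to radii at most
  \<open>sc k / 8\<close> since larger annuli of a bounded space may be empty.
  \<open>base_point\<close> serves the confluence of branches, \<open>inner\<close> the inner balls
  of cells, \<open>near\<close> and \<open>split\<close> the contact between cells.\<close>

locale net_tree =
  fixes T :: "'t set" and \<pi> :: "'t \<Rightarrow> 't" and \<phi> :: 't and lev :: "'t \<Rightarrow> int"
    and pos :: "'t \<Rightarrow> 'a::metric_space" and rooted :: bool
    and sc :: "int \<Rightarrow> real" and r A c \<gamma> :: real
  assumes complete: "complete (UNIV :: 'a set)"
    and doubling: "doubling_space TYPE('a)"
    and not_isolated: "no_isolated_points TYPE('a)"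
    and countable_T: "countable T"
    and sc_pos: "0 < sc k"
    and sc_step: "sc (k + 1) = r * sc k"
    and r_pos: "0 < r"
    and A_ge: "4 \<le> A"
    and c_pos: "0 < c" and c_le: "c \<le> 1/4"
    and r_le: "8 * (A + 1) * r \<le> c"
    and gamma: "1 < \<gamma>"
    and perfect: "(rooted \<Longrightarrow> 0 \<le> k) \<Longrightarrow> 0 < \<rho> \<Longrightarrow> \<rho> \<le> sc k / 8 \<Longrightarrow>
        \<exists>y. \<rho> \<le> dist x y \<and> dist x y < \<gamma> * \<rho>"
    and small: "rooted \<Longrightarrow> dist (x::'a) y < sc 0"
    and root_in: "\<phi> \<in> T" and lev_root: "lev \<phi> = 0"
    and pi_in: "w \<in> T \<Longrightarrow> \<pi> w \<in> T"
    and lev_pi: "w \<in> T \<Longrightarrow> lev (\<pi> w) = (if rooted then max 0 (lev w - 1) else lev w - 1)"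
    and lev_nonneg: "rooted \<Longrightarrow> w \<in> T \<Longrightarrow> 0 \<le> lev w"
    and lev_0: "rooted \<Longrightarrow> w \<in> T \<Longrightarrow> lev w = 0 \<Longrightarrow> w = \<phi>"
    and separated: "w \<in> T \<Longrightarrow> v \<in> T \<Longrightarrow> lev w = lev v \<Longrightarrow> w \<noteq> v \<Longrightarrow> sc (lev w) \<le> dist (pos w) (pos v)"
    and covering: "(rooted \<Longrightarrow> 0 \<le> k) \<Longrightarrow> \<exists>w\<in>T. lev w = k \<and> dist x (pos w) < sc k"
    and base_point: "\<not> rooted \<Longrightarrow> \<exists>w\<in>T. lev w = k \<and> pos w = pos \<phi>"
    and inner: "w \<in> T \<Longrightarrow> v \<in> T \<Longrightarrow> lev v = lev w + 1 \<Longrightarrow> dist (pos v) (pos w) < c * sc (lev w) \<Longrightarrow> \<pi> v = w"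
    and near: "v \<in> T \<Longrightarrow> lev (\<pi> v) = lev v - 1 \<Longrightarrow>
        \<exists>w\<in>T. lev w = lev v - 1 \<and> dist (pos v) (pos w) \<le> sc (lev w) \<and>
              dist (pos w) (pos (\<pi> v)) \<le> A * sc (lev w)"
    and split: "w \<in> T \<Longrightarrow> v \<in> T \<Longrightarrow> lev w = lev v \<Longrightarrow> dist (pos w) (pos v) \<le> A * sc (lev w) \<Longrightarrow>
        \<exists>w'\<in>T. \<exists>v'\<in>T. \<pi> w' = w \<and> \<pi> v' = v \<and> lev w' = lev w + 1 \<and> lev v' = lev w + 1 \<and>
              dist (pos w') (pos v') \<le> A * sc (lev w + 1)"
begin

section \<open>Scales, levels and the distance to ancestors\<close>

lemma r_small: "r \<le> 1 / 160"
proof -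
  have "5 * r \<le> (A + 1) * r"
    using A_ge r_pos by (intro mult_right_mono) auto
  then show ?thesis
    using r_le c_le by linarith
qed

lemma sc_add: "sc (k + int n) = r ^ n * sc k"
proof (induction n)
  case (Suc n)
  have "sc (k + int (Suc n)) = sc ((k + int n) + 1)"
    by (simp add: add_ac)
  then show ?case
    using Suc by (simp only: sc_step) simp
qed simp

lemma sc_prev: "sc k = r * sc (k - 1)"
  using sc_step[of "k - 1"] by simp

lemma sc_mono: "k \<le> l \<Longrightarrow> sc l \<le> sc k"
proof -
  assume "k \<le> l"
  then have "sc l = r ^ nat (l - k) * sc k"
    using sc_add[of k "nat (l - k)"] by simp
  moreover have "r ^ nat (l - k) \<le> 1"
    using r_pos r_small by (intro power_le_one) auto
  ultimately show ?thesis
    using sc_pos[of k] by (simp add: mult_left_le_one_le r_pos less_imp_le)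
qed

lemma sc_powi: "sc k = sc 0 * r powi k"
proof (cases "0 \<le> k")
  case True
  then show ?thesis
    using sc_add[of 0 "nat k"] by (simp add: power_int_nonneg_exp)
next
  case False
  then have "sc 0 = r ^ nat (- k) * sc k"
    using sc_add[of k "nat (- k)"] by simp
  moreover have "r ^ nat (- k) * r powi k = 1"
    using False r_pos by (simp add: power_int_def power_inverse)
  ultimately show ?thesis
    by (metis mult.assoc mult.commute mult.right_neutral)
qed

lemma sc_tendsto_0: "0 < e \<Longrightarrow> \<exists>n. sc (k + int n) < e"
proof -
  assume "0 < e"
  then obtain n where "r ^ n < e / sc k"
    using real_arch_pow_inv[of "e / sc k" r] sc_pos[of k] r_small by auto
  then show ?thesis
    using sc_pos[of k] by (auto simp: sc_add field_simps)
qed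

lemma sc_unbounded: "\<exists>n. R < sc (k - int n)"
proof -
  define R' where "R' = max R 1"
  obtain n where n: "r ^ n < sc k / R'"
    using real_arch_pow_inv[of "sc k / R'" r] sc_pos[of k] r_small by (auto simp: R'_def)
  have "sc k = r ^ n * sc (k - int n)"
    using sc_add[of "k - int n" n] by simp
  moreover have "R' * r ^ n < sc k"
    using n by (simp add: R'_def field_simps)
  ultimately have "R' < sc (k - int n)"
    using r_pos by (simp add: mult.commute)
  then show ?thesis by (auto simp: R'_def)
qed

lemma funpow_in: "w \<in> T \<Longrightarrow> (\<pi> ^^ n) w \<in> T"
  by (induction n) (auto simp: pi_in)

lemma lev_funpow:
  "w \<in> T \<Longrightarrow> lev ((\<pi> ^^ n) w) = (if rooted then max 0 (lev w - int n) else lev w - int n)"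
proof (induction n)
  case 0
  then show ?case using lev_nonneg by auto
next
  case (Suc n)
  then show ?case using lev_pi[OF funpow_in[of w n]] by auto
qed

lemma ancestor:
  assumes "u \<in> T" "k \<le> lev u" "rooted \<Longrightarrow> 0 \<le> k"
  shows "(\<pi> ^^ nat (lev u - k)) u \<in> T \<and> lev ((\<pi> ^^ nat (lev u - k)) u) = k"
  using assms by (auto simp: funpow_in lev_funpow)

lemma parent_dist:
  assumes "v \<in> T" "lev (\<pi> v) = lev v - 1"
  shows "dist (pos v) (pos (\<pi> v)) \<le> (A + 1) * sc (lev v - 1)"
proof -
  obtain w where w: "lev w = lev v - 1" "dist (pos v) (pos w) \<le> sc (lev w)"
    "dist (pos w) (pos (\<pi> v)) \<le> A * sc (lev w)"
    using near[OF assms] by blast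
  then show ?thesis
    using dist_triangle[of "pos v" "pos (\<pi> v)" "pos w"] unfolding w(1) by (simp add: algebra_simps)
qed

text \<open>A step to the parent costs at most \<open>A + 1\<close> times the parent's scale, and
  since \<open>2 * r \<le> 1\<close> the geometric sum is at most twice its last term. The
  hypothesis on the level keeps the path from idling at the root.\<close>

lemma ancestor_dist:
  assumes "u \<in> T" "lev ((\<pi> ^^ n) u) = lev u - int n"
  shows "dist (pos u) (pos ((\<pi> ^^ n) u)) \<le> 2 * (A + 1) * (sc (lev u - int n) - sc (lev u))"
  using assms(2)
proof (induction n)
  case (Suc n)
  let ?v = "(\<pi> ^^ n) u"
  \<comment> \<open>In the rooted case levels of ancestors are truncated at \<open>0\<close>; this
    shows that no truncation has occurred so far.\<close>
  have "0 \<le> lev u - int (Suc n)" if rooted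
    using lev_nonneg[OF that funpow_in[OF assms(1), of "Suc n"]] Suc.prems by linarith
  then have v: "?v \<in> T" "lev ?v = lev u - int n"
    using lev_funpow[OF assms(1), of n] funpow_in[OF assms(1), of n] by (cases rooted; simp)+
  then have v': "lev (\<pi> ?v) = lev ?v - 1"
    using Suc.prems by simp
  define s where "s = sc (lev u - int (Suc n))"
  have "lev u - int n - 1 = lev u - int (Suc n)"
    by simp
  then have s: "sc (lev u - int n) = r * s" "sc (lev ?v - 1) = s"
    using sc_prev[of "lev u - int n"] v(2) by (metis s_def)+
  have "s > 0" by (simp add: s_def sc_pos)
  have "dist (pos u) (pos ((\<pi> ^^ Suc n) u)) \<le> dist (pos u) (pos ?v) + dist (pos ?v) (pos (\<pi> ?v))"
    by (simp add: dist_triangle)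
  also have "\<dots> \<le> 2 * (A + 1) * (r * s - sc (lev u)) + (A + 1) * s"
    using Suc.IH[OF v(2)] parent_dist[OF v(1) v'] unfolding s by linarith
  also have "\<dots> = 2 * (A + 1) * (s - sc (lev u)) - (A + 1) * s * (1 - 2 * r)"
    by (simp add: algebra_simps)
  also have "\<dots> \<le> 2 * (A + 1) * (s - sc (lev u))"
    using \<open>s > 0\<close> A_ge r_small by simp
  finally show ?case
    by (simp add: s_def)
qed simp

section \<open>Cells: size, covering, inner balls and children\<close>

definition strict_desc :: "'t \<Rightarrow> 't set" where
  "strict_desc w = {u \<in> T. lev w < lev u \<and> (\<pi> ^^ nat (lev u - lev w)) u = w}"

definition cell :: "'t \<Rightarrow> 'a set" where
  "cell w = closure (pos ` strict_desc w)"

lemma strict_desc_dist: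
  assumes "u \<in> strict_desc w"
  shows "dist (pos u) (pos w) \<le> 2 * (A + 1) * sc (lev w)"
proof -
  have u: "u \<in> T" "lev w < lev u" "(\<pi> ^^ nat (lev u - lev w)) u = w"
    using assms by (auto simp: strict_desc_def)
  then have "dist (pos u) (pos w) \<le> 2 * (A + 1) * (sc (lev w) - sc (lev u))"
    using ancestor_dist[OF u(1), of "nat (lev u - lev w)"] by simp
  also have "\<dots> \<le> 2 * (A + 1) * sc (lev w)"
    using A_ge sc_pos[of "lev u"] by simp
  finally show ?thesis .
qed

lemma cell_subset_cball: "cell w \<subseteq> cball (pos w) (2 * (A + 1) * sc (lev w))"
  unfolding cell_def using strict_desc_dist by (intro closure_minimal) (auto simp: dist_commute simp del: distrib_left_numeral)

lemma dist_cell_le: "x \<in> cell w \<Longrightarrow> dist (pos w) x \<le> 2 * (A + 1) * sc (lev w)"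
  using cell_subset_cball[of w] by (meson mem_cball subsetD)

lemma pos_strict_desc_in_cell: "u \<in> strict_desc w \<Longrightarrow> pos u \<in> cell w"
  using closure_subset[of "pos ` strict_desc w"] by (auto simp: cell_def)

lemma compact_cell: "compact (cell w)"
  using compact_cball_doubling[OF complete doubling] cell_subset_cball
  by (metis cell_def closed_Int_compact closed_closure inf.absorb1)

lemma bounded_cell: "bounded (cell w)"
  by (simp add: compact_cell compact_imp_bounded)

text \<open>The witness is the ancestor of \<open>u\<close> just below \<open>w\<close>. Its
  distance to \<open>u\<close> is of the order of the child scale, a small fraction of
  \<open>sc (lev w)\<close>, so descendants of \<open>w\<close> can be traded for children of
  \<open>w\<close>.\<close>

lemma strict_desc_child:
  assumes "u \<in> strict_desc w" "w \<in> T"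
  obtains u' where "u' \<in> T" "lev u' = lev w + 1" "\<pi> u' = w"
    "dist (pos u) (pos u') \<le> 2 * (A + 1) * sc (lev w + 1)" "u = u' \<or> u \<in> strict_desc u'"
proof
  define m where "m = nat (lev u - lev w - 1)"
  have u: "u \<in> T" "lev u = lev w + 1 + int m" "(\<pi> ^^ Suc m) u = w"
    using assms by (auto simp: strict_desc_def m_def Suc_nat_eq_nat_zadd1)
  let ?u' = "(\<pi> ^^ m) u"
  show "?u' \<in> T" using u by (simp add: funpow_in)
  show l: "lev ?u' = lev w + 1"
    using u lev_nonneg[OF _ assms(2)] by (auto simp: lev_funpow)
  show "\<pi> ?u' = w" using u by simp
  have "dist (pos u) (pos ?u') \<le> 2 * (A + 1) * (sc (lev w + 1) - sc (lev u))"
    using ancestor_dist[OF u(1), of m] l u(2) by simp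
  also have "\<dots> \<le> 2 * (A + 1) * sc (lev w + 1)"
    using A_ge sc_pos[of "lev u"] by simp
  finally show "dist (pos u) (pos ?u') \<le> 2 * (A + 1) * sc (lev w + 1)" .
  have "nat (lev u - lev ?u') = m"
    using u(2) l by simp
  then have "u \<in> strict_desc ?u'" if "m \<noteq> 0"
    using that u(1,2) l by (simp add: strict_desc_def)
  then show "u = ?u' \<or> u \<in> strict_desc ?u'"
    by (cases "m = 0") auto
qed

text \<open>Only \<open>2 * J + 1\<close> levels occur, and on each of them the positions are
  separated by at least \<open>sc (k + int J) = r ^ J * sc k\<close>; the doubling bound for this
  ratio is uniform in \<open>x\<close> and \<open>k\<close>.\<close>

lemma finite_nearby:
  "\<exists>N. \<forall>x k. finite {v \<in> T. \<bar>lev v - k\<bar> \<le> int J \<and> dist (pos v) x \<le> L * sc k} \<and>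
           card {v \<in> T. \<bar>lev v - k\<bar> \<le> int J \<and> dist (pos v) x \<le> L * sc k} \<le> N"
proof -
  obtain N where N: "\<And>(x::'a) s S. \<lbrakk>0 < s; S \<subseteq> cball x (max 0 L / r ^ J * s);
      \<forall>y\<in>S. \<forall>z\<in>S. y \<noteq> z \<longrightarrow> s \<le> dist y z\<rbrakk> \<Longrightarrow> finite S \<and> card S \<le> N"
    using doubling_separated_card[OF doubling, of "max 0 L / r ^ J"] by blast
  have level: "finite {v \<in> T. lev v = l \<and> dist (pos v) x \<le> L * sc k} \<and>
      card {v \<in> T. lev v = l \<and> dist (pos v) x \<le> L * sc k} \<le> N" (is "finite ?V \<and> card ?V \<le> N")
    if "l \<in> {k - int J..k + int J}" for x l k
  proof -
    have inj: "inj_on pos ?V"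
    proof (rule inj_onI, rule ccontr)
      fix v w assume "v \<in> ?V" "w \<in> ?V" "pos v = pos w" "v \<noteq> w"
      then have "sc l \<le> 0"
        using separated[of v w] by simp
      then show False
        using sc_pos[of l] by linarith
    qed
    have "L * sc k \<le> max 0 L * sc k"
      using sc_pos[of k] by (intro mult_right_mono) auto
    also have "\<dots> = max 0 L / r ^ J * sc (k + int J)"
      using r_pos by (simp add: sc_add)
    also have "\<dots> \<le> max 0 L / r ^ J * sc l"
      using that r_pos sc_mono[of l "k + int J"] by (intro mult_left_mono) auto
    finally have "pos ` ?V \<subseteq> cball x (max 0 L / r ^ J * sc l)"
      by (auto simp: dist_commute)
    moreover have "\<forall>y\<in>pos ` ?V. \<forall>z\<in>pos ` ?V. y \<noteq> z \<longrightarrow> sc l \<le> dist y z"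
    proof clarify
      fix v w assume "v \<in> T" "w \<in> T" "l = lev v" "lev w = lev v" "pos v \<noteq> pos w"
      then show "sc (lev v) \<le> dist (pos v) (pos w)"
        using separated[of v w] by metis
    qed
    ultimately have "finite (pos ` ?V) \<and> card (pos ` ?V) \<le> N"
      by (rule N[OF sc_pos])
    then show ?thesis
      using inj by (simp add: card_image finite_image_iff)
  qed
  have "finite {v \<in> T. \<bar>lev v - k\<bar> \<le> int J \<and> dist (pos v) x \<le> L * sc k} \<and>
      card {v \<in> T. \<bar>lev v - k\<bar> \<le> int J \<and> dist (pos v) x \<le> L * sc k} \<le> (2 * J + 1) * N" for x k
  proof -
    let ?I = "{k - int J..k + int J}" and ?V = "\<lambda>l. {v \<in> T. lev v = l \<and> dist (pos v) x \<le> L * sc k}"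
    have eq: "{v \<in> T. \<bar>lev v - k\<bar> \<le> int J \<and> dist (pos v) x \<le> L * sc k} = (\<Union>l\<in>?I. ?V l)"
      by auto
    have "card (\<Union>l\<in>?I. ?V l) \<le> (\<Sum>l\<in>?I. card (?V l))"
      by (rule card_UN_le) auto
    also have "\<dots> \<le> (\<Sum>l\<in>?I. N)"
      using level by (intro sum_mono) auto
    finally have "card (\<Union>l\<in>?I. ?V l) \<le> (2 * J + 1) * N"
      by (simp add: nat_add_distrib nat_mult_distrib)
    moreover have "finite (\<Union>l\<in>?I. ?V l)"
      using level by (intro finite_UN_I) blast+
    ultimately show ?thesis
      unfolding eq by blast
  qed
  then show ?thesis by blast
qed

text \<open>Deep vertices approximate \<open>x\<close>, and their ancestors of level
  \<open>k\<close> all lie in one finite set \<open>F\<close>. Hence \<open>x\<close> is in the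
  closure of a finite union of closed cells.\<close>

lemma cell_cover:
  assumes "rooted \<Longrightarrow> 0 \<le> k"
  shows "\<exists>w\<in>T. lev w = k \<and> x \<in> cell w"
proof -
  define F where "F = {w \<in> T. \<bar>lev w - k\<bar> \<le> int 0 \<and> dist (pos w) x \<le> (2 * (A + 1) + 1) * sc k}"
  have "finite F"
    unfolding F_def using finite_nearby[of 0 "2 * (A + 1) + 1"] by blast
  have "closed (\<Union>w\<in>F. cell w)"
    using \<open>finite F\<close> by (auto simp: cell_def)
  moreover have "x \<in> closure (\<Union>w\<in>F. cell w)"
    unfolding closure_approachable
  proof (intro allI impI)
    fix e :: real assume "0 < e"
    \<comment> \<open>The extra \<open>1\<close> puts \<open>u\<close> strictly below level
      \<open>k\<close>, as \<open>strict_desc\<close> demands.\<close>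
    then obtain n where n: "sc (k + 1 + int n) < e"
      using sc_tendsto_0 by blast
    obtain u where u: "u \<in> T" "lev u = k + 1 + int n" "dist x (pos u) < sc (k + 1 + int n)"
      using covering[of "k + 1 + int n" x] assms by auto
    define w where "w = (\<pi> ^^ nat (lev u - k)) u"
    have w: "w \<in> T" "lev w = k"
      using ancestor[OF u(1), of k] u(2) assms by (auto simp: w_def)
    have uw: "u \<in> strict_desc w"
      using u w by (auto simp: strict_desc_def w_def)
    have "dist (pos w) x \<le> dist (pos u) (pos w) + dist x (pos u)"
      by (metis add.commute dist_commute dist_triangle)
    also have "\<dots> \<le> (2 * (A + 1) + 1) * sc k"
      using strict_desc_dist[OF uw] u(3) sc_mono[of k "k + 1 + int n"] w by (simp add: algebra_simps)
    finally have "w \<in> F"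
      using w by (auto simp: F_def)
    moreover have "pos u \<in> cell w"
      using uw by (rule pos_strict_desc_in_cell)
    ultimately show "\<exists>y\<in>\<Union>w\<in>F. cell w. dist y x < e"
      using u(3) n by (auto simp: dist_commute intro!: bexI[of _ w] bexI[of _ "pos u"])
  qed
  ultimately have "x \<in> (\<Union>w\<in>F. cell w)"
    by (simp add: closure_closed)
  then show ?thesis
    by (auto simp: F_def)
qed

text \<open>A descendant of \<open>v\<close> in this ball would have its ancestor just below
  \<open>v\<close> within \<open>c * sc (lev w)\<close> of \<open>w\<close>, and
  \<open>inner\<close> would make that ancestor a child of \<open>w\<close>.\<close>

lemma cell_disjoint_ball:
  assumes "w \<in> T" "v \<in> T" "lev w = lev v" "w \<noteq> v"
  shows "cell v \<inter> ball (pos w) (c / 2 * sc (lev w)) = {}"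
proof (rule ccontr)
  assume "\<not> ?thesis"
  then have "pos ` strict_desc v \<inter> ball (pos w) (c / 2 * sc (lev w)) \<noteq> {}"
    unfolding cell_def using open_Int_closure_eq_empty[OF open_ball] by (metis inf_commute)
  then obtain u where u: "u \<in> strict_desc v" "dist (pos w) (pos u) < c / 2 * sc (lev w)"
    by auto
  obtain u' where u': "u' \<in> T" "lev u' = lev v + 1" "\<pi> u' = v"
    "dist (pos u) (pos u') \<le> 2 * (A + 1) * sc (lev v + 1)"
    using strict_desc_child[OF u(1) assms(2)] by metis
  have "2 * (A + 1) * sc (lev v + 1) = (8 * (A + 1) * r) / 4 * sc (lev w)"
    by (simp add: sc_step assms(3))
  also have "\<dots> \<le> c / 4 * sc (lev w)"
    using r_le sc_pos[of "lev w"] by (intro mult_right_mono) auto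
  also have "\<dots> \<le> c / 2 * sc (lev w)"
    using c_pos sc_pos[of "lev w"] by simp
  finally have "dist (pos u') (pos w) < c * sc (lev w)"
    using u(2) u'(4) dist_triangle[of "pos u'" "pos w" "pos u"] by (simp add: dist_commute)
  then have "\<pi> u' = w"
    using inner[OF assms(1) u'(1)] u'(2) assms(3) by simp
  then show False
    using u'(3) assms(4) by simp
qed

text \<open>The cells of the level cover the space, and all the others miss this ball.\<close>

lemma ball_subset_cell:
  assumes "w \<in> T"
  shows "ball (pos w) (c / 2 * sc (lev w)) \<subseteq> cell w"
proof
  fix y assume y: "y \<in> ball (pos w) (c / 2 * sc (lev w))"
  obtain v where "v \<in> T" "lev v = lev w" "y \<in> cell v"
    using cell_cover[of "lev w" y] lev_nonneg[OF _ assms] by blast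
  then show "y \<in> cell w"
    using cell_disjoint_ball[OF assms, of v] y by fastforce
qed

lemma pos_in_cell: "w \<in> T \<Longrightarrow> pos w \<in> cell w"
  using ball_subset_cell[of w] c_pos sc_pos[of "lev w"] by (auto simp: subset_iff)

lemma diameter_cell_le: "w \<in> T \<Longrightarrow> diameter (cell w) \<le> 4 * (A + 1) * sc (lev w)"
proof (rule diameter_leI)
  assume "w \<in> T"
  then show "cell w \<noteq> {}" using pos_in_cell by blast
  fix x y assume "x \<in> cell w" "y \<in> cell w"
  note this[THEN dist_cell_le]
  then show "dist x y \<le> 4 * (A + 1) * sc (lev w)"
    using dist_triangle3[of x y "pos w"] by linarith
qed

text \<open>\<open>\<rho>\<close> is chosen such that \<open>\<gamma> * \<rho>\<close> is below the
  radius of the inner ball; uniform perfectness then places a point of the cell at distance at least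
  \<open>\<rho>\<close> from its centre.\<close>

lemma diameter_cell_ge:
  assumes "w \<in> T"
  shows "c / (8 * \<gamma>) * sc (lev w) \<le> diameter (cell w)"
proof -
  define \<rho> where "\<rho> = c / (8 * \<gamma>) * sc (lev w)"
  have "\<rho> > 0"
    using c_pos gamma sc_pos[of "lev w"] by (simp add: \<rho>_def)
  have "c / (8 * \<gamma>) \<le> 1 / 8"
    using c_pos c_le gamma by (simp add: field_simps)
  then have "\<rho> \<le> 1 / 8 * sc (lev w)"
    unfolding \<rho>_def using sc_pos[of "lev w"] by (intro mult_right_mono) auto
  then obtain y where y: "\<rho> \<le> dist (pos w) y" "dist (pos w) y < \<gamma> * \<rho>"
    using perfect[of "lev w" \<rho> "pos w"] lev_nonneg[OF _ assms] \<open>\<rho> > 0\<close> by auto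
  have "\<gamma> * \<rho> = c / 8 * sc (lev w)"
    using gamma by (simp add: \<rho>_def)
  also have "\<dots> \<le> c / 2 * sc (lev w)"
    using c_pos sc_pos[of "lev w"] by simp
  finally have "y \<in> cell w"
    using y ball_subset_cell[OF assms] by auto
  then show ?thesis
    using diameter_bounded_bound[OF bounded_cell pos_in_cell[OF assms]] y(1) unfolding \<rho>_def
    by fastforce
qed

lemma diameter_cell_pos: "w \<in> T \<Longrightarrow> 0 < diameter (cell w)"
  using diameter_cell_ge[of w] c_pos gamma sc_pos[of "lev w"]
  by (smt (verit) divide_pos_pos mult_pos_pos)

lemma strict_desc_trans:
  assumes "\<pi> v = w" "lev v = lev w + 1" "u \<in> strict_desc v"
  shows "u \<in> strict_desc w"
proof -
  have u: "u \<in> T" "lev v < lev u" "(\<pi> ^^ nat (lev u - lev v)) u = v"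
    using assms(3) by (auto simp: strict_desc_def)
  then have "nat (lev u - lev w) = Suc (nat (lev u - lev v))"
    using assms(2) by simp
  then show ?thesis
    using u assms(1,2) by (auto simp: strict_desc_def)
qed

lemma child_cell_subset: "\<pi> v = w \<Longrightarrow> lev v = lev w + 1 \<Longrightarrow> cell v \<subseteq> cell w"
  unfolding cell_def by (intro closure_mono image_mono) (auto intro: strict_desc_trans)

lemma cell_parent:
  assumes "v \<in> T"
  shows "cell v \<subseteq> cell (\<pi> v)"
proof (cases "lev (\<pi> v) = lev v - 1")
  case True
  then show ?thesis by (intro child_cell_subset) auto
next
  case False
  then have "rooted" "lev v = 0" "lev (\<pi> v) = 0"
    using lev_pi[OF assms] lev_nonneg[OF _ assms] by (auto split: if_splits)
  then show ?thesis
    using assms pi_in lev_0 by (metis order_refl)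
qed

lemma cell_funpow: "v \<in> T \<Longrightarrow> cell v \<subseteq> cell ((\<pi> ^^ n) v)"
  by (induction n) (use cell_parent funpow_in in fastforce)+

lemma finite_children: "\<exists>N. \<forall>w\<in>T. finite {v \<in> T. \<pi> v = w} \<and> card {v \<in> T. \<pi> v = w} \<le> N"
proof -
  obtain N where N: "\<And>x k. finite {v \<in> T. \<bar>lev v - k\<bar> \<le> int 1 \<and> dist (pos v) x \<le> (A + 1) * sc k} \<and>
           card {v \<in> T. \<bar>lev v - k\<bar> \<le> int 1 \<and> dist (pos v) x \<le> (A + 1) * sc k} \<le> N"
    using finite_nearby[of 1 "A + 1"] by blast
  have "{v \<in> T. \<pi> v = w} \<subseteq> {v \<in> T. \<bar>lev v - lev w\<bar> \<le> int 1 \<and> dist (pos v) (pos w) \<le> (A + 1) * sc (lev w)}"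
    if "w \<in> T" for w
  proof (clarify, intro conjI)
    fix v assume v: "v \<in> T" "w = \<pi> v"
    show "\<bar>lev v - lev (\<pi> v)\<bar> \<le> int 1"
      using lev_pi[OF v(1)] lev_nonneg[OF _ v(1)] by (auto split: if_splits)
    show "dist (pos v) (pos (\<pi> v)) \<le> (A + 1) * sc (lev (\<pi> v))"
    proof (cases "lev (\<pi> v) = lev v - 1")
      case True
      then show ?thesis using parent_dist[OF v(1)] by simp
    next
      case False
      then have "rooted" "lev v = 0" "lev (\<pi> v) = 0"
        using lev_pi[OF v(1)] lev_nonneg[OF _ v(1)] by (auto split: if_splits)
      then have "v = \<phi>" "\<pi> v = \<phi>"
        using v(1) pi_in lev_0 by metis+
      then show ?thesis
        using A_ge sc_pos[of "lev \<phi>"] by simp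
    qed
  qed
  then show ?thesis
    using N by (meson card_mono finite_subset order_trans)
qed

text \<open>There are finitely many children, so the union is closed and only the positions of
  descendants matter. As \<open>strict_desc\<close> excludes \<open>w\<close> itself, each such
  position already belongs to the cell of a child.\<close>

lemma cell_children:
  assumes "w \<in> T"
  shows "(\<Union>v\<in>{v \<in> T. \<pi> v = w} - {w}. cell v) = cell w"
proof
  show "(\<Union>v\<in>{v \<in> T. \<pi> v = w} - {w}. cell v) \<subseteq> cell w"
    using cell_parent by blast
  have "finite {v \<in> T. \<pi> v = w}"
    using finite_children assms by blast
  then have "closed (\<Union>v\<in>{v \<in> T. \<pi> v = w} - {w}. cell v)"
    by (auto simp: cell_def)
  moreover have "pos ` strict_desc w \<subseteq> (\<Union>v\<in>{v \<in> T. \<pi> v = w} - {w}. cell v)"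
  proof clarify
    fix u assume "u \<in> strict_desc w"
    then obtain u' where u': "u' \<in> T" "lev u' = lev w + 1" "\<pi> u' = w" "u = u' \<or> u \<in> strict_desc u'"
      using strict_desc_child assms by metis
    then have "pos u \<in> cell u'"
      using pos_in_cell pos_strict_desc_in_cell by auto
    then show "pos u \<in> (\<Union>v\<in>{v \<in> T. \<pi> v = w} - {w}. cell v)"
      using u' by auto
  qed
  ultimately show "cell w \<subseteq> (\<Union>v\<in>{v \<in> T. \<pi> v = w} - {w}. cell v)"
    unfolding cell_def by (simp add: closure_minimal)
qed

section \<open>Contact between cells\<close>

lemma adjacent_descendants:
  assumes "w \<in> T" "v \<in> T" "lev w = lev v" "dist (pos w) (pos v) \<le> A * sc (lev w)"
  shows "\<exists>w'\<in>strict_desc w. \<exists>v'\<in>strict_desc v. lev w' = lev w + 1 + int n \<and> lev v' = lev w + 1 + int n \<and>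
     dist (pos w') (pos v') \<le> A * sc (lev w + 1 + int n)"
  using assms
proof (induction n arbitrary: w v)
  case 0
  obtain w' v' where "w' \<in> T" "v' \<in> T" "\<pi> w' = w" "\<pi> v' = v" "lev w' = lev w + 1" "lev v' = lev w + 1"
      "dist (pos w') (pos v') \<le> A * sc (lev w + 1)"
    using split[OF 0] by blast
  then show ?case
    using 0 by (intro bexI[of _ w'] bexI[of _ v']) (auto simp: strict_desc_def)
next
  case (Suc n)
  obtain w' v' where *: "w' \<in> T" "v' \<in> T" "\<pi> w' = w" "\<pi> v' = v" "lev w' = lev w + 1" "lev v' = lev w + 1"
      "dist (pos w') (pos v') \<le> A * sc (lev w + 1)"
    using split[OF Suc.prems] by blast
  then obtain w'' v'' where "w'' \<in> strict_desc w'" "v'' \<in> strict_desc v'"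
      "lev w'' = lev w' + 1 + int n" "lev v'' = lev w' + 1 + int n"
      "dist (pos w'') (pos v'') \<le> A * sc (lev w' + 1 + int n)"
    using Suc.IH[of w' v'] by auto
  then show ?case
    using * Suc.prems strict_desc_trans
    by (intro bexI[of _ w''] bexI[of _ v'']) (auto simp: algebra_simps)
qed

text \<open>Iterating \<open>split\<close> gives points of the two cells at distances tending to
  \<open>0\<close>; by compactness a subsequence converges, to a point of both.\<close>

lemma adjacent_cells_meet:
  assumes "w \<in> T" "v \<in> T" "lev w = lev v" "dist (pos w) (pos v) \<le> A * sc (lev w)"
  shows "cell w \<inter> cell v \<noteq> {}"
proof -
  have "\<forall>n. \<exists>x y. x \<in> cell w \<and> y \<in> cell v \<and> dist x y \<le> A * sc (lev w + 1 + int n)"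
    using adjacent_descendants[OF assms] pos_strict_desc_in_cell by meson
  then obtain x y where xy: "\<And>n. x n \<in> cell w" "\<And>n. y n \<in> cell v"
      "\<And>n. dist (x n) (y n) \<le> A * sc (lev w + 1 + int n)"
    by metis
  obtain l f where l: "l \<in> cell w" "strict_mono f" "(x \<circ> f) \<longlonglongrightarrow> l"
    using compact_cell[of w, unfolded compact_def, rule_format, of x] xy(1) by blast
  have "(\<lambda>n. r ^ n) \<longlonglongrightarrow> 0"
    using r_pos r_small by (intro LIMSEQ_realpow_zero) auto
  then have "(\<lambda>n. A * (r ^ n * sc (lev w + 1))) \<longlonglongrightarrow> A * (0 * sc (lev w + 1))"
    by (intro tendsto_mult tendsto_const)
  then have lim: "(\<lambda>n. A * sc (lev w + 1 + int n)) \<longlonglongrightarrow> 0"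
    by (simp add: sc_add)
  have "(\<lambda>n. dist (x n) (y n)) \<longlonglongrightarrow> 0"
    by (rule tendsto_sandwich[OF _ _ tendsto_const lim]) (auto simp: xy)
  then have "((\<lambda>n. dist (x n) (y n)) \<circ> f) \<longlonglongrightarrow> 0"
    using l(2) by (rule LIMSEQ_subseq_LIMSEQ)
  moreover have "(\<lambda>n. dist ((x \<circ> f) n) l) \<longlonglongrightarrow> 0"
    using l(3) by (rule tendsto_dist_iff[THEN iffD1])
  ultimately have "(\<lambda>n. dist (x (f n)) (y (f n)) + dist (x (f n)) l) \<longlonglongrightarrow> 0 + 0"
    by (intro tendsto_add) (simp_all add: o_def)
  then have lim: "(\<lambda>n. dist (x (f n)) (y (f n)) + dist (x (f n)) l) \<longlonglongrightarrow> 0"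
    by simp
  have "(\<lambda>n. dist (y (f n)) l) \<longlonglongrightarrow> 0"
    by (rule tendsto_sandwich[OF _ _ tendsto_const lim]) (auto simp: dist_triangle3)
  then have "(\<lambda>n. y (f n)) \<longlonglongrightarrow> l"
    by (rule tendsto_dist_iff[THEN iffD2])
  moreover have "closed (cell v)"
    by (simp add: cell_def)
  ultimately have "l \<in> cell v"
    using xy(2) by (intro closed_sequentially[of "cell v" "\<lambda>n. y (f n)" l]) auto
  then show ?thesis using l(1) by blast
qed

text \<open>The position of \<open>v\<close> is only known to be within
  \<open>2 * (A + 1) * sc (lev v)\<close> of \<open>x\<close>; the substitute \<open>w\<close> is
  close enough to serve in adjacency arguments, and its cell still touches that of \<open>v\<close>.
  The bound adds \<open>1/4\<close> for a descendant near \<open>x\<close>, \<open>1/4\<close> for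
  its ancestor just below \<open>v\<close>, and \<open>1\<close> from \<open>near\<close>.\<close>

lemma nearby_vertex:
  assumes "v \<in> T" "x \<in> cell v"
  shows "\<exists>w\<in>T. lev w = lev v \<and> dist x (pos w) \<le> 3 / 2 * sc (lev v) \<and> cell w \<inter> cell v \<noteq> {}"
proof -
  have "0 < sc (lev v) / 4"
    by (simp add: sc_pos)
  then obtain u where u: "u \<in> strict_desc v" "dist (pos u) x < sc (lev v) / 4"
    using assms(2) unfolding cell_def closure_approachable by blast
  obtain u' where u': "u' \<in> T" "lev u' = lev v + 1" "\<pi> u' = v"
    "dist (pos u) (pos u') \<le> 2 * (A + 1) * sc (lev v + 1)"
    using strict_desc_child[OF u(1) assms(1)] by metis
  have "2 * (A + 1) * sc (lev v + 1) = (8 * (A + 1) * r) / 4 * sc (lev v)"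
    by (simp add: sc_step)
  also have "\<dots> \<le> 1 / 4 * sc (lev v)"
    using r_le c_le sc_pos[of "lev v"] by (intro mult_right_mono) auto
  finally have a: "dist (pos u) (pos u') \<le> 1 / 4 * sc (lev v)"
    using u'(4) by linarith
  obtain w where w: "w \<in> T" "lev w = lev u' - 1" "dist (pos u') (pos w) \<le> sc (lev w)"
      "dist (pos w) (pos (\<pi> u')) \<le> A * sc (lev w)"
    using near[OF u'(1)] u'(2,3) by auto
  have "dist x (pos w) \<le> dist (pos u) x + dist (pos u) (pos u') + dist (pos u') (pos w)"
    by (metis (no_types, opaque_lifting) add.commute add_le_cancel_left dist_commute dist_triangle2 dist_triangle_le order_trans)
  also have "\<dots> \<le> 3 / 2 * sc (lev v)"
    using a u(2) w(2,3) u'(2) by simp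
  finally show ?thesis
    using w u' adjacent_cells_meet[OF w(1) assms(1)] by auto
qed

subsection \<open>The tree and the partition\<close>

lemma pi_root: "rooted \<Longrightarrow> \<pi> \<phi> = \<phi>"
  using lev_pi[OF root_in] lev_root lev_0[OF _ pi_in[OF root_in]] by simp

lemma funpow_root: "rooted \<Longrightarrow> (\<pi> ^^ n) \<phi> = \<phi>"
  by (induction n) (auto simp: pi_root)

lemma funpow_lev: "rooted \<Longrightarrow> w \<in> T \<Longrightarrow> (\<pi> ^^ n) w = \<phi> \<longleftrightarrow> lev w \<le> int n"
  using lev_funpow[of w n] funpow_in[of w n] lev_0[of "(\<pi> ^^ n) w"] lev_root by auto

lemma periodic_points_eq: "periodic_points T \<pi> = (if rooted then {\<phi>} else {})"
proof (cases rooted)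
  case True
  have "w = \<phi>" if "w \<in> T" "n \<ge> 1" "(\<pi> ^^ n) w = w" for w n
  proof -
    have "lev w = max 0 (lev w - int n)"
      using lev_funpow[OF that(1), of n] True that(3) by simp
    then have "lev w = 0"
      using that(2) by linarith
    then show ?thesis
      using lev_0[OF True that(1)] by blast
  qed
  moreover have "\<exists>n\<ge>1. (\<pi> ^^ n) \<phi> = \<phi>"
    using funpow_root[OF True] by blast
  ultimately show ?thesis
    using True root_in by (auto simp: periodic_points_def)
next
  case False
  have "(\<pi> ^^ n) w \<noteq> w" if "w \<in> T" "n \<ge> 1" for w n
    using lev_funpow[OF that(1), of n] False that(2) by auto
  then show ?thesis
    using False by (auto simp: periodic_points_def)
qed

text \<open>Far up, the distance of the ancestors of \<open>w\<close> to the base point is small compared with the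
  scale, so that they are captured by the vertices over the base point.\<close>

lemma eventually_base_point:
  assumes "\<not> rooted" "w \<in> T"
  shows "\<exists>n0. \<forall>n\<ge>n0. pos ((\<pi> ^^ n) w) = pos \<phi>"
proof -
  define e where "e = dist (pos w) (pos \<phi>)"
  \<comment> \<open>From here on \<open>e\<close> is below half of the radius \<open>c * S\<close>
    in \<open>inner\<close>; the other half absorbs the displacement of the ancestor.\<close>
  obtain n0 where n0: "2 * e / c < sc (lev w - int n0)"
    using sc_unbounded by blast
  have base: "pos ((\<pi> ^^ Suc n) w) = pos \<phi>" if "n \<ge> n0" for n
  proof -
    let ?v = "(\<pi> ^^ n) w"
    have v: "?v \<in> T" "lev ?v = lev w - int n"
      using assms by (auto simp: funpow_in lev_funpow)
    define S where "S = sc (lev ?v - 1)"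
    have S: "sc (lev ?v) = r * S" "0 < S"
      using sc_prev[of "lev ?v"] sc_pos by (simp_all add: S_def)
    have "2 * e / c < S"
      using n0 sc_mono[of "lev ?v - 1" "lev w - int n0"] v(2) that by (simp add: S_def)
    then have e: "e < c / 2 * S"
      using c_pos by (simp add: field_simps)
    have "dist (pos w) (pos ?v) \<le> 2 * (A + 1) * (r * S - sc (lev w))"
      using ancestor_dist[OF assms(2), of n] v(2) S(1) by simp
    also have "\<dots> \<le> (8 * (A + 1) * r) / 4 * S"
      using A_ge sc_pos[of "lev w"] by (simp add: algebra_simps)
    also have "\<dots> \<le> c / 4 * S"
      using r_le S(2) by (intro mult_right_mono) auto
    also have "\<dots> \<le> c / 2 * S"
      using c_pos S(2) by simp
    finally have "dist (pos ?v) (pos \<phi>) < c * S"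
      using e dist_triangle3[of "pos ?v" "pos \<phi>" "pos w"] by (simp add: e_def dist_commute)
    moreover obtain b where b: "b \<in> T" "lev b = lev ?v - 1" "pos b = pos \<phi>"
      using base_point[OF assms(1)] by blast
    ultimately have "\<pi> ?v = b"
      using inner[OF b(1) v(1)] by (simp add: S_def)
    then show ?thesis
      using b(3) by simp
  qed
  have "pos ((\<pi> ^^ n) w) = pos \<phi>" if "n \<ge> Suc n0" for n
    using base[of "n - 1"] that by (cases n) auto
  then show ?thesis by blast
qed

lemma confluent:
  assumes "w \<in> T" "v \<in> T"
  shows "\<exists>n m. (\<pi> ^^ n) w = (\<pi> ^^ m) v"
proof (cases rooted)
  case True
  then have "(\<pi> ^^ nat (lev w)) w = \<phi>" "(\<pi> ^^ nat (lev v)) v = \<phi>"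
    using assms by (auto simp: funpow_lev)
  then show ?thesis by metis
next
  case False
  obtain n1 n2 where n: "\<And>n. n \<ge> n1 \<Longrightarrow> pos ((\<pi> ^^ n) w) = pos \<phi>"
    "\<And>n. n \<ge> n2 \<Longrightarrow> pos ((\<pi> ^^ n) v) = pos \<phi>"
    using eventually_base_point[OF False] assms by meson
  \<comment> \<open>At most one of the two \<open>nat\<close> terms is nonzero; they bring both
    ancestors to the same level, where equal positions mean equal vertices.\<close>
  define n m where "n = n1 + n2 + nat (lev w - lev v)" and "m = n1 + n2 + nat (lev v - lev w)"
  have "pos ((\<pi> ^^ n) w) = pos ((\<pi> ^^ m) v)"
    using n by (simp add: n_def m_def)
  moreover have lev: "lev ((\<pi> ^^ n) w) = lev ((\<pi> ^^ m) v)"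
    using False assms by (simp add: lev_funpow n_def m_def)
  ultimately have "(\<pi> ^^ n) w = (\<pi> ^^ m) v"
    using separated[OF funpow_in[OF assms(1)] funpow_in[OF assms(2)] lev] sc_pos
    by (metis dist_self not_le)
  then show ?thesis by blast
qed

lemma tree: "tree_with_reference_point T \<pi> \<phi>"
  unfolding tree_with_reference_point_def periodic_points_eq
  using countable_T root_in pi_in confluent by auto

text \<open>In the rooted case \<open>\<phi>\<close> is fixed and the heights are \<open>0\<close>
  and \<open>nat (lev w)\<close>. Otherwise, comparing levels gives
  \<open>int n - int m = lev w\<close> whenever \<open>(\<pi> ^^ n) w = (\<pi> ^^ m) \<phi>\<close>;
  each height occurs in such a pair and is minimal in its coordinate, which forces their difference
  to be \<open>lev w\<close> as well.\<close>

lemma level_eq: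
  assumes "w \<in> T"
  shows "level \<pi> \<phi> w = lev w"
proof (cases rooted)
  case True
  have "(\<pi> ^^ nat (lev w)) w = \<phi>"
    using assms True by (simp add: funpow_lev)
  then have "confluence_height \<pi> \<phi> w = 0"
    unfolding confluence_height_def
    by (intro Least_eq_0 exI[of _ "nat (lev w)"]) simp
  moreover have "confluence_height \<pi> w \<phi> = nat (lev w)"
    unfolding confluence_height_def
    using assms True by (intro Least_equality) (auto simp: funpow_root funpow_lev)
  ultimately show ?thesis
    using lev_nonneg[OF True assms] by (simp add: level_def)
next
  case False
  let ?P = "\<lambda>n m. (\<pi> ^^ n) w = (\<pi> ^^ m) \<phi>"
  have diff: "int n - int m = lev w" if "?P n m" for n m
    using lev_funpow[OF assms, of n] lev_funpow[OF root_in, of m] that False lev_root by auto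
  obtain n m where "?P n m"
    using confluent[OF assms root_in] by blast
  let ?a = "confluence_height \<pi> w \<phi>" and ?b = "confluence_height \<pi> \<phi> w"
  have "\<exists>m. ?P ?a m"
    unfolding confluence_height_def by (rule LeastI[of "\<lambda>n. \<exists>m. ?P n m"], rule exI) fact
  then obtain m0 where m0: "?P ?a m0" ..
  have "\<exists>n. (\<pi> ^^ ?b) \<phi> = (\<pi> ^^ n) w"
    unfolding confluence_height_def
    by (rule LeastI[of "\<lambda>m. \<exists>n. (\<pi> ^^ m) \<phi> = (\<pi> ^^ n) w"], rule exI) (rule \<open>?P n m\<close>[symmetric])
  then obtain n1 where "(\<pi> ^^ ?b) \<phi> = (\<pi> ^^ n1) w" ..
  note n1 = this[symmetric]
  have "?a \<le> n1"
    unfolding confluence_height_def by (rule Least_le, rule exI, rule n1)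
  moreover have "?b \<le> m0"
    unfolding confluence_height_def by (rule Least_le, rule exI, rule m0[symmetric])
  ultimately show ?thesis
    using diff[OF m0] diff[OF n1] by (simp add: level_def)
qed

lemma level_set_eq: "level_set T \<pi> \<phi> k = {w \<in> T. lev w = k}"
  using level_eq by (auto simp: level_set_def)

text \<open>In the rooted case some \<open>w j\<close> lies below the root, for otherwise the
  sequence would be constant. From such an index on the levels grow by one and the diameters tend to
  \<open>0\<close>; compactness supplies a common point.\<close>

lemma cell_sequence:
  assumes w: "\<And>k::int. w k \<in> T" "\<nexists>c. \<forall>k. w k = c" "\<And>k. \<pi> (w (k + 1)) = w k"
  shows "\<exists>x. (\<Inter>k. cell (w k)) = {x}"
proof -
  have "\<exists>j. \<not> rooted \<or> 0 < lev (w j)"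
  proof (rule ccontr)
    assume "\<not> ?thesis"
    then have "rooted" "\<And>j. lev (w j) \<le> 0"
      by (auto simp: not_less)
    then have "w j = \<phi>" for j
      using lev_nonneg[OF _ w(1)[of j]] lev_0[OF _ w(1)[of j]] by (simp add: order_antisym)
    then show False using w(2) by blast
  qed
  then obtain j where j: "\<not> rooted \<or> 0 < lev (w j)" by blast
  have step: "lev (w (k + 1)) = lev (w k) + 1" if "\<not> rooted \<or> 0 < lev (w k)" for k
    using lev_pi[OF w(1)[of "k + 1"]] that unfolding w(3) by (auto split: if_splits)
  have lev: "lev (w (j + int n)) = lev (w j) + int n" for n
  proof (induction n)
    case (Suc n)
    have "lev (w (j + int n + 1)) = lev (w (j + int n)) + 1"
      using Suc j by (intro step) auto
    then show ?case
      using Suc by (simp add: add_ac)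
  qed simp
  have "cell (w (k + int n)) \<subseteq> cell (w k)" for k n
  proof (induction n)
    case (Suc n)
    have "cell (w (k + int n + 1)) \<subseteq> cell (w (k + int n))"
      using cell_parent[OF w(1)[of "k + int n + 1"]] unfolding w(3) .
    then show ?case
      using Suc by (simp add: add_ac)
  qed simp
  then have mono: "cell (w l) \<subseteq> cell (w k)" if "k \<le> l" for k l
  proof -
    have "l = k + int (nat (l - k))"
      using that by simp
    then show ?thesis
      using \<open>\<And>k n. cell (w (k + int n)) \<subseteq> cell (w k)\<close>[of k "nat (l - k)"] by (rule ssubst)
  qed
  have "cell (w j) \<inter> (\<Inter>k\<in>UNIV. cell (w k)) \<noteq> {}"
  proof (rule compact_imp_fip_image[OF compact_cell])
    fix I :: "int set" assume "finite I"
    then have "pos (w (Max (insert j I))) \<in> cell (w i)" if "i \<in> insert j I" for i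
      using mono[OF Max_ge[OF _ that]] pos_in_cell[OF w(1)] by blast
    then show "cell (w j) \<inter> (\<Inter>i\<in>I. cell (w i)) \<noteq> {}" by blast
  qed (simp add: cell_def)
  then obtain x where "x \<in> (\<Inter>k. cell (w k))" by blast
  then have x: "x \<in> cell (w k)" for k by blast
  have "y = x" if y: "\<And>k. y \<in> cell (w k)" for y
  proof (rule ccontr)
    assume "y \<noteq> x"
    then have "0 < dist y x / (4 * (A + 1))"
      using A_ge by simp
    then obtain n where "sc (lev (w j) + int n) < dist y x / (4 * (A + 1))"
      using sc_tendsto_0 by blast
    then have "4 * (A + 1) * sc (lev (w j) + int n) < dist y x"
      using A_ge by (simp add: field_simps)
    moreover have "dist y x \<le> diameter (cell (w (j + int n)))"
      by (intro diameter_bounded_bound bounded_cell x y)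
    moreover have "\<dots> \<le> 4 * (A + 1) * sc (lev (w j) + int n)"
      using diameter_cell_le[OF w(1), of "j + int n"] unfolding lev .
    ultimately show False by linarith
  qed
  then have "(\<Inter>k. cell (w k)) = {x}"
    using x by auto
  then show ?thesis by (rule exI)
qed

lemma sigma_compact: "sigma_compact_space TYPE('a)"
  unfolding sigma_compact_space_def
proof (intro exI conjI allI)
  show "compact (cball (pos \<phi>) (real n))" for n
    by (rule compact_cball_doubling[OF complete doubling])
  show "(\<Union>n. cball (pos \<phi>) (real n)) = UNIV"
    using real_arch_simple by auto
qed

lemma partition: "is_partition T \<pi> \<phi> cell"
  unfolding is_partition_def level_set_eq
proof (intro conjI ballI allI impI)
  fix w assume "w \<in> T"
  show "cell w \<noteq> {}" using pos_in_cell[OF \<open>w \<in> T\<close>] by blast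
  show "\<nexists>x. cell w = {x}"
    using diameter_cell_pos[OF \<open>w \<in> T\<close>] by auto
next
  show "(\<Union>w\<in>{w \<in> T. lev w = 0}. cell w) = UNIV"
    using cell_cover[of 0] by auto
qed (use sigma_compact not_isolated compact_cell cell_children cell_sequence in auto)

subsection \<open>The basic framework\<close>

text \<open>The last inequality is not strict because of the exceptional scale
  \<open>{\<phi>}\<close>, where \<open>\<pi> \<phi> = \<phi>\<close> and \<open>s\<close> is the
  diameter of its cell.\<close>

lemma scale_diameter:
  assumes "w \<in> scale T \<pi> \<phi> cell s"
  shows "w \<in> T" "diameter (cell w) \<le> s" "s \<le> diameter (cell (\<pi> w))"
  using assms root_in pi_root by (auto simp: scale_def periodic_points_eq split: if_splits)

lemma diameter_parent_le:
  assumes "w \<in> T"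
  shows "diameter (cell (\<pi> w)) \<le> 4 * (A + 1) / r * sc (lev w)"
proof -
  have "lev w - 1 \<le> lev (\<pi> w)"
    using lev_pi[OF assms] by auto
  then have "4 * (A + 1) * sc (lev (\<pi> w)) \<le> 4 * (A + 1) * sc (lev w - 1)"
    using A_ge by (intro mult_left_mono sc_mono) auto
  also have "\<dots> = 4 * (A + 1) / r * sc (lev w)"
    using sc_prev[of "lev w"] r_pos by simp
  finally show ?thesis
    using diameter_cell_le[OF pi_in[OF assms]] by linarith
qed

lemma sc_comparable: "\<exists>J. \<forall>k l. sc k \<le> Q * sc l \<longrightarrow> l - k \<le> int J"
proof -
  define Q' where "Q' = max Q 1"
  have "0 < 1 / Q'" "r < 1"
    using r_small by (auto simp: Q'_def)
  then obtain J where J: "r ^ J < 1 / Q'"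
    using real_arch_pow_inv by blast
  have "l - k \<le> int J" if "sc k \<le> Q * sc l" for k l
  proof (rule ccontr)
    assume "\<not> ?thesis"
    then have "sc l \<le> sc (k + int J)"
      by (intro sc_mono) auto
    also have "\<dots> < 1 / Q' * sc k"
      using J sc_pos[of k] unfolding sc_add by (intro mult_strict_right_mono)
    finally have "Q' * sc l < sc k"
      by (simp add: Q'_def field_simps)
    moreover have "Q * sc l \<le> Q' * sc l"
      using sc_pos[of l] by (intro mult_right_mono) (auto simp: Q'_def)
    ultimately show False
      using that by linarith
  qed
  then show ?thesis by blast
qed

text \<open>For \<open>w\<close> and \<open>v\<close> in the same scale,
  \<open>diameter (cell w) \<le> s \<le> diameter (cell (\<pi> v))\<close>, which bounds
  \<open>sc (lev w)\<close> by a constant times \<open>sc (lev v)\<close>.\<close>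

lemma scale_comparable:
  "\<exists>J. \<forall>s. \<forall>w\<in>scale T \<pi> \<phi> cell s. \<forall>v\<in>scale T \<pi> \<phi> cell s. \<bar>lev v - lev w\<bar> \<le> int J"
proof -
  define a b where "a = 4 * (A + 1) / r" and "b = c / (8 * \<gamma>)"
  have "0 < b"
    using c_pos gamma by (simp add: b_def)
  obtain J where J: "\<And>k l. sc k \<le> a / b * sc l \<Longrightarrow> l - k \<le> int J"
    using sc_comparable by blast
  have *: "lev v - lev w \<le> int J" if "w \<in> scale T \<pi> \<phi> cell s" "v \<in> scale T \<pi> \<phi> cell s" for s v w
  proof (rule J)
    have "b * sc (lev w) \<le> a * sc (lev v)"
      using scale_diameter[OF that(1)] scale_diameter[OF that(2)] diameter_cell_ge[of w]
        diameter_parent_le[of v] unfolding a_def b_def by linarith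
    then show "sc (lev w) \<le> a / b * sc (lev v)"
      using \<open>0 < b\<close> by (simp add: field_simps)
  qed
  have "\<bar>lev v - lev w\<bar> \<le> int J" if "w \<in> scale T \<pi> \<phi> cell s" "v \<in> scale T \<pi> \<phi> cell s" for s v w
    using *[OF that] *[OF that(2,1)] by linarith
  then show ?thesis
    by (intro exI[of _ J]) blast
qed

text \<open>A walk of length \<open>n\<close> visits \<open>n + 1\<close> cells of diameter at most
  \<open>s\<close>, consecutive ones sharing a point.\<close>

lemma scale_chain_dist:
  assumes "(w, v) \<in> scale_edges T \<pi> \<phi> cell s ^^ n" "w \<in> scale T \<pi> \<phi> cell s" "x \<in> cell w" "y \<in> cell v"
  shows "dist x y \<le> real (n + 1) * s"
  using assms(1,4)
proof (induction n arbitrary: v y)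
  case 0
  then have "dist x y \<le> diameter (cell w)"
    using assms(3) by (intro diameter_bounded_bound bounded_cell) auto
  then show ?case
    using scale_diameter(2)[OF assms(2)] by simp
next
  case (Suc n)
  then obtain u where u: "(w, u) \<in> scale_edges T \<pi> \<phi> cell s ^^ n" "(u, v) \<in> scale_edges T \<pi> \<phi> cell s"
    by (auto elim: relpow_Suc_E)
  then obtain z where z: "z \<in> cell u" "z \<in> cell v" "v \<in> scale T \<pi> \<phi> cell s"
    by (auto simp: scale_edges_def)
  have "dist z y \<le> diameter (cell v)"
    using z Suc.prems by (intro diameter_bounded_bound bounded_cell) auto
  then have "dist z y \<le> s"
    using scale_diameter(2)[OF z(3)] by linarith
  moreover have "dist x z \<le> real (n + 1) * s"
    using Suc.IH[OF u(1) z(1)] .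
  ultimately show ?case
    using dist_triangle[of x y z] by (simp add: algebra_simps)
qed

section \<open>Comparison of \<open>delta\<close> with the metric\<close>

lemma delta_nonneg: "0 \<le> delta T \<pi> \<phi> K M x y"
  unfolding delta_def by (intro INF_greatest) auto

lemma dist_le_delta: "ereal (dist x y) \<le> ereal (real (M + 1)) * delta T \<pi> \<phi> cell M x y"
proof -
  have "ereal (dist x y / real (M + 1)) \<le> delta T \<pi> \<phi> cell M x y"
    unfolding delta_def
  proof (rule INF_greatest, clarify)
    fix s w v
    assume *: "0 < s" "w \<in> scale T \<pi> \<phi> cell s" "x \<in> cell w" "y \<in> cell v"
      "scale_dist T \<pi> \<phi> cell s w v \<le> enat M"
    then obtain n where n: "n \<le> M" "(w, v) \<in> scale_edges T \<pi> \<phi> cell s ^^ n"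
      by (auto simp: scale_dist_def graph_dist_le_iff)
    have "dist x y \<le> real (n + 1) * s"
      using scale_chain_dist[OF n(2)] * by blast
    also have "\<dots> \<le> real (M + 1) * s"
      using n(1) \<open>0 < s\<close> by (intro mult_right_mono) auto
    finally show "ereal (dist x y / real (M + 1)) \<le> ereal s"
      by (simp add: field_simps)
  qed
  then have "ereal (real (M + 1)) * ereal (dist x y / real (M + 1)) \<le>
      ereal (real (M + 1)) * delta T \<pi> \<phi> cell M x y"
    by (intro ereal_mult_left_mono) auto
  then show ?thesis by simp
qed

lemma delta_le:
  assumes "0 < s" "w \<in> scale T \<pi> \<phi> cell s" "v \<in> scale T \<pi> \<phi> cell s" "x \<in> cell w" "y \<in> cell v"
    "n \<le> M" "(w, v) \<in> scale_edges T \<pi> \<phi> cell s ^^ n"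
  shows "delta T \<pi> \<phi> cell M x y \<le> ereal s"
  unfolding delta_def
proof (rule INF_lower)
  have "scale_dist T \<pi> \<phi> cell s w v \<le> enat M"
    using assms(6,7) by (auto simp: scale_dist_def graph_dist_le_iff)
  then show "s \<in> {s. 0 < s \<and> (\<exists>w\<in>scale T \<pi> \<phi> cell s. \<exists>v\<in>scale T \<pi> \<phi> cell s.
      x \<in> cell w \<and> y \<in> cell v \<and> scale_dist T \<pi> \<phi> cell s w v \<le> enat M)}"
    using assms by blast
qed

text \<open>Going up from \<open>u\<close>, the diameters eventually exceed \<open>s\<close>; the
  ancestor just before the first excess lies in the scale. The third hypothesis excludes the two
  exceptional cases in the definition of \<open>scale\<close>.\<close>

lemma ancestor_in_scale:
  assumes "u \<in> T" "diameter (cell u) \<le> s" "\<not> (rooted \<and> diameter (cell \<phi>) \<le> s)"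
  shows "\<exists>u'\<in>scale T \<pi> \<phi> cell s. cell u \<subseteq> cell u'"
proof -
  have "\<exists>n. s < diameter (cell ((\<pi> ^^ n) u))"
  proof (cases rooted)
    case True
    then have "(\<pi> ^^ nat (lev u)) u = \<phi>"
      using assms(1) by (simp add: funpow_lev)
    then show ?thesis
      using assms(3) True by (metis not_le)
  next
    case False
    define b where "b = c / (8 * \<gamma>)"
    have "0 < b"
      using c_pos gamma by (simp add: b_def)
    obtain n where "s / b < sc (lev u - int n)"
      using sc_unbounded by blast
    then have "s < b * sc (lev u - int n)"
      using \<open>0 < b\<close> by (simp add: field_simps)
    also have "\<dots> \<le> diameter (cell ((\<pi> ^^ n) u))"
      using diameter_cell_ge[OF funpow_in[OF assms(1), of n]] lev_funpow[OF assms(1), of n] False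
      by (simp add: b_def)
    finally show ?thesis by blast
  qed
  note ex = this
  define n where "n = (LEAST n. s < diameter (cell ((\<pi> ^^ n) u)))"
  have n: "s < diameter (cell ((\<pi> ^^ n) u))"
    unfolding n_def by (rule LeastI_ex[OF ex])
  then obtain m where m: "n = Suc m"
    using assms(2) by (cases n) auto
  have "diameter (cell ((\<pi> ^^ m) u)) \<le> s"
    using not_less_Least[of m "\<lambda>n. s < diameter (cell ((\<pi> ^^ n) u))"] m
    unfolding n_def[symmetric] by simp
  moreover have "s < diameter (cell (\<pi> ((\<pi> ^^ m) u)))"
    using n m by simp
  ultimately have "(\<pi> ^^ m) u \<in> scale T \<pi> \<phi> cell s"
    using funpow_in[OF assms(1), of m] assms(3) by (auto simp: scale_def periodic_points_eq)
  then show ?thesis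
    using cell_funpow[OF assms(1)] by blast
qed

text \<open>The parameter \<open>4 * (A + 1) * sc k\<close> bounds the diameters of the cells of
  level \<open>k\<close>, so that, short of the exceptional cases, each of them lies in a cell of
  that scale. The chain is \<open>a\<close>, \<open>b'\<close>, \<open>e'\<close>, \<open>d\<close>:
  the outer cells contain the points, and the middle ones contain cells of level \<open>k\<close>
  whose vertices are within \<open>(3/2 + 1 + 3/2) * sc k \<le> A * sc k\<close> of each
  other.\<close>

lemma delta_le_sc:
  assumes "rooted \<Longrightarrow> 0 \<le> k" "dist x y \<le> sc k"
  shows "delta T \<pi> \<phi> cell 3 x y \<le> ereal (4 * (A + 1) * sc k)"
\<comment> \<open>At or beyond the diameter of the whole space the scale is empty or
  \<open>{\<phi>}\<close>; then the parameter \<open>diameter (cell \<phi>)\<close> is used, for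
  which \<open>\<phi>\<close> alone joins \<open>x\<close> and \<open>y\<close>.\<close>
proof (cases "rooted \<and> diameter (cell \<phi>) \<le> 4 * (A + 1) * sc k")
  case True
  let ?s = "diameter (cell \<phi>)"
  have phi: "\<phi> \<in> scale T \<pi> \<phi> cell ?s"
    using True by (simp add: scale_def periodic_points_eq)
  have "z \<in> cell \<phi>" for z
    using cell_cover[of 0 z] lev_0 True by blast
  then have "delta T \<pi> \<phi> cell 3 x y \<le> ereal ?s"
    using delta_le[OF diameter_cell_pos[OF root_in] phi phi, of x y 0] by simp
  also have "\<dots> \<le> ereal (4 * (A + 1) * sc k)"
    using True by simp
  finally show ?thesis .
next
  case False
  let ?s = "4 * (A + 1) * sc k" and ?E = "scale_edges T \<pi> \<phi> cell (4 * (A + 1) * sc k)"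
  have up: "\<exists>u'\<in>scale T \<pi> \<phi> cell ?s. cell u \<subseteq> cell u'" if "u \<in> T" "lev u = k" for u
    using ancestor_in_scale[OF that(1) _ False] diameter_cell_le[OF that(1)] that(2) by blast
  have point: "\<exists>v'\<in>scale T \<pi> \<phi> cell ?s. \<exists>w\<in>T. \<exists>w'\<in>scale T \<pi> \<phi> cell ?s. z \<in> cell v' \<and> cell v' \<inter> cell w' \<noteq> {} \<and>
     lev w = k \<and> dist z (pos w) \<le> 3 / 2 * sc k \<and> cell w \<subseteq> cell w'" for z
  proof -
    obtain v where v: "v \<in> T" "lev v = k" "z \<in> cell v"
      using cell_cover[OF assms(1)] by blast
    obtain w where w: "w \<in> T" "lev w = k" "dist z (pos w) \<le> 3 / 2 * sc k" "cell w \<inter> cell v \<noteq> {}"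
      using nearby_vertex[OF v(1,3)] v(2) by auto
    obtain v' w' where "v' \<in> scale T \<pi> \<phi> cell ?s" "cell v \<subseteq> cell v'"
        "w' \<in> scale T \<pi> \<phi> cell ?s" "cell w \<subseteq> cell w'"
      using up[OF v(1,2)] up[OF w(1,2)] by blast
    then show ?thesis
      using v w by (intro bexI[of _ v'] bexI[of _ w] bexI[of _ w']) auto
  qed
  obtain a b b' where a: "a \<in> scale T \<pi> \<phi> cell ?s" "b \<in> T" "b' \<in> scale T \<pi> \<phi> cell ?s" "x \<in> cell a"
      "cell a \<inter> cell b' \<noteq> {}" "lev b = k" "dist x (pos b) \<le> 3 / 2 * sc k" "cell b \<subseteq> cell b'"
    using point[of x] by blast
  obtain d e e' where d: "d \<in> scale T \<pi> \<phi> cell ?s" "e \<in> T" "e' \<in> scale T \<pi> \<phi> cell ?s" "y \<in> cell d"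
      "cell d \<inter> cell e' \<noteq> {}" "lev e = k" "dist y (pos e) \<le> 3 / 2 * sc k" "cell e \<subseteq> cell e'"
    using point[of y] by blast
  have "dist (pos b) (pos e) \<le> dist x (pos b) + dist x y + dist y (pos e)"
    using dist_triangle[of "pos b" "pos e" x] dist_triangle[of x "pos e" y] by (simp add: dist_commute)
  also have "\<dots> \<le> 4 * sc k"
    using a(7) d(7) assms(2) by simp
  also have "\<dots> \<le> A * sc k"
    using A_ge sc_pos[of k] by (intro mult_right_mono) auto
  finally have "cell b \<inter> cell e \<noteq> {}"
    using adjacent_cells_meet[OF a(2) d(2)] a(6) d(6) by simp
  then have "cell b' \<inter> cell e' \<noteq> {}"
    using a(8) d(8) by blast
  \<comment> \<open>\<open>scale_edges\<close> has no loops, so coinciding members of the chain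
    shorten the walk; hence a bound on the length rather than an exact value.\<close>
  moreover have step: "\<exists>n\<le>Suc m. (p, t) \<in> ?E ^^ n"
    if "\<exists>n\<le>m. (p, q) \<in> ?E ^^ n" "q \<in> scale T \<pi> \<phi> cell ?s" "t \<in> scale T \<pi> \<phi> cell ?s" "cell q \<inter> cell t \<noteq> {}"
    for p q t m
  proof (cases "q = t")
    case True
    then show ?thesis using that(1) le_SucI by blast
  next
    case False
    then have "(q, t) \<in> ?E"
      using that by (auto simp: scale_edges_def)
    then show ?thesis
      using that(1) by (meson Suc_le_mono relpow_Suc_I)
  qed
  moreover have "\<exists>n\<le>0. (a, a) \<in> ?E ^^ n"
    by simp
  ultimately have "\<exists>n\<le>Suc (Suc (Suc 0)). (a, d) \<in> ?E ^^ n"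
    using a d by (intro step[of "Suc (Suc 0)" a e' d] step[of "Suc 0" a b' e'] step[of 0 a a b']) auto
  then obtain n where "n \<le> 3" "(a, d) \<in> ?E ^^ n"
    by (auto simp: numeral_3_eq_3)
  moreover have "0 < ?s"
    using A_ge sc_pos[of k] by simp
  ultimately show ?thesis
    using delta_le a(1,4) d(1,4) by blast
qed

text \<open>\<open>k\<close> comes just before the first level, counted from \<open>k0\<close>,
  whose scale drops below \<open>d\<close>. In the rooted case the search starts at level
  \<open>0\<close>, which the second hypothesis permits; otherwise it starts high enough up.\<close>

lemma sc_choice:
  assumes "0 < d" "rooted \<Longrightarrow> d < sc 0"
  shows "\<exists>k. (rooted \<longrightarrow> 0 \<le> k) \<and> d \<le> sc k \<and> r * sc k \<le> d"
proof -
  have "\<exists>k. (rooted \<longrightarrow> k = 0) \<and> d < sc k"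
    using assms(2) sc_unbounded[of d 0] by blast
  then obtain k0 where k0: "rooted \<longrightarrow> k0 = 0" "d < sc k0"
    by blast
  define n where "n = (LEAST n. sc (k0 + int n) < d)"
  have n: "sc (k0 + int n) < d" "\<And>m. m < n \<Longrightarrow> d \<le> sc (k0 + int m)"
    using LeastI_ex[OF sc_tendsto_0[OF assms(1), of k0]] not_less_Least
    unfolding n_def by (auto simp: not_less[symmetric])
  then obtain m where m: "n = Suc m"
    using k0(2) by (cases n) auto
  have "sc (k0 + int n) = r * sc (k0 + int m)"
    using sc_step[of "k0 + int m"] m by (simp add: add_ac)
  then show ?thesis
    using n m k0 by (intro exI[of _ "k0 + int m"]) auto
qed

lemma delta_le_dist: "delta T \<pi> \<phi> cell 3 x y \<le> ereal (4 * (A + 1) / r * dist x y)"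
proof (cases "x = y")
  case True
  \<comment> \<open>No level matches the distance \<open>0\<close>, so arbitrarily deep levels are
    used.\<close>
  have "delta T \<pi> \<phi> cell 3 x y \<le> 0 + ereal e" if "0 < e" for e
  proof -
    have "0 < e / (4 * (A + 1))"
      using that A_ge by simp
    then obtain n where n: "sc (0 + int n) < e / (4 * (A + 1))"
      using sc_tendsto_0 by blast
    have "delta T \<pi> \<phi> cell 3 x y \<le> ereal (4 * (A + 1) * sc (0 + int n))"
      using sc_pos True by (intro delta_le_sc) (auto simp: less_imp_le)
    also have "\<dots> \<le> ereal e"
      using n A_ge by (simp add: field_simps)
    finally show ?thesis by simp
  qed
  then have "delta T \<pi> \<phi> cell 3 x y \<le> 0"
    by (rule ereal_le_epsilon2)
  then show ?thesis
    using True by (simp add: zero_ereal_def)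
next
  case False
  then obtain k where k: "rooted \<longrightarrow> 0 \<le> k" "dist x y \<le> sc k" "r * sc k \<le> dist x y"
    using sc_choice[of "dist x y"] small by auto
  have "delta T \<pi> \<phi> cell 3 x y \<le> ereal (4 * (A + 1) * sc k)"
    using k by (intro delta_le_sc) auto
  moreover have "4 * (A + 1) / r * (r * sc k) \<le> 4 * (A + 1) / r * dist x y"
    using k(3) A_ge r_pos by (intro mult_left_mono) auto
  then have "4 * (A + 1) * sc k \<le> 4 * (A + 1) / r * dist x y"
    using r_pos by simp
  ultimately show ?thesis
    by (meson ereal_less_eq(3) order_trans)
qed

lemma delta_comparable:
  "\<exists>M\<ge>1. \<exists>\<eta>>0. \<forall>x y. ereal (inverse \<eta>) * delta T \<pi> \<phi> cell M x y \<le> ereal (dist x y) \<and>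
     ereal (dist x y) \<le> ereal \<eta> * delta T \<pi> \<phi> cell M x y"
proof -
  define \<eta> where "\<eta> = max 4 (4 * (A + 1) / r)"
  have eta: "0 < \<eta>" "4 \<le> \<eta>" "4 * (A + 1) / r \<le> \<eta>"
    by (auto simp: \<eta>_def)
  have "ereal (inverse \<eta>) * delta T \<pi> \<phi> cell 3 x y \<le> ereal (dist x y)" for x y
  proof -
    have "4 * (A + 1) / r * dist x y \<le> \<eta> * dist x y"
      using eta by (intro mult_right_mono) auto
    then have "delta T \<pi> \<phi> cell 3 x y \<le> ereal (\<eta> * dist x y)"
      using delta_le_dist[of x y] by (meson ereal_less_eq(3) order_trans)
    then have "ereal (inverse \<eta>) * delta T \<pi> \<phi> cell 3 x y \<le> ereal (inverse \<eta>) * ereal (\<eta> * dist x y)"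
      using eta by (intro ereal_mult_left_mono) auto
    also have "\<dots> = ereal (dist x y)"
      using eta by simp
    finally show ?thesis .
  qed
  moreover have "ereal (dist x y) \<le> ereal \<eta> * delta T \<pi> \<phi> cell 3 x y" for x y
  proof -
    have "ereal (dist x y) \<le> ereal 4 * delta T \<pi> \<phi> cell 3 x y"
      using dist_le_delta[of x y 3] by simp
    also have "\<dots> \<le> ereal \<eta> * delta T \<pi> \<phi> cell 3 x y"
      using eta by (intro ereal_mult_right_mono delta_nonneg) auto
    finally show ?thesis .
  qed
  ultimately show ?thesis
    using eta(1) by (intro exI[of _ 3] exI[of _ \<eta>] conjI allI) auto
qed

lemma delta_ball_subset_cell:
  "\<exists>\<eta>>0. \<forall>w\<in>T. \<exists>x\<in>cell w. {y. delta T \<pi> \<phi> cell 1 x y \<le> ereal (\<eta> * diameter (cell (\<pi> w)))} \<subseteq> cell w"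
proof (intro exI conjI ballI)
  \<comment> \<open>Together with the factor \<open>2 = M + 1\<close> for \<open>M = 1\<close> and
    the bound on the parent's diameter this yields \<open>c / 4 * sc (lev w)\<close>, inside the
    inner ball.\<close>
  define \<eta> where "\<eta> = c * r / (32 * (A + 1))"
  show "0 < \<eta>"
    using c_pos r_pos A_ge by (simp add: \<eta>_def)
  fix w assume w: "w \<in> T"
  have "y \<in> cell w" if "delta T \<pi> \<phi> cell 1 (pos w) y \<le> ereal (\<eta> * diameter (cell (\<pi> w)))" for y
  proof -
    have "ereal (dist (pos w) y) \<le> ereal 2 * delta T \<pi> \<phi> cell 1 (pos w) y"
      using dist_le_delta[of "pos w" y 1] by simp
    also have "\<dots> \<le> ereal 2 * ereal (\<eta> * diameter (cell (\<pi> w)))"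
      using that by (intro ereal_mult_left_mono) auto
    finally have "dist (pos w) y \<le> 2 * (\<eta> * diameter (cell (\<pi> w)))"
      by simp
    also have "\<dots> \<le> 2 * (\<eta> * (4 * (A + 1) / r * sc (lev w)))"
      using diameter_parent_le[OF w] \<open>0 < \<eta>\<close> by (intro mult_left_mono) auto
    also have "\<dots> = c / 4 * sc (lev w)"
    proof -
      have "2 * (c * r / (32 * B) * (4 * B / r * S)) = c / 4 * S" if "B \<noteq> 0" for B S
        using that r_pos by (simp add: field_simps)
      moreover have "A + 1 \<noteq> 0"
        using A_ge by simp
      ultimately show ?thesis
        unfolding \<eta>_def by blast
    qed
    also have "\<dots> < c / 2 * sc (lev w)"
      using c_pos sc_pos[of "lev w"] by simp
    finally show ?thesis
      using ball_subset_cell[OF w] by auto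
  qed
  then show "\<exists>x\<in>cell w. {y. delta T \<pi> \<phi> cell 1 x y \<le> ereal (\<eta> * diameter (cell (\<pi> w)))} \<subseteq> cell w"
    using pos_in_cell[OF w] by blast
qed

text \<open>Neighbours in a scale have positions within \<open>2 * s\<close>, at most a constant
  times \<open>sc (lev w)\<close>, and levels differing by at most \<open>J\<close>, so
  \<open>finite_nearby\<close> counts them uniformly.\<close>

lemma scale_neighbours:
  "uniformly_finite {{v \<in> scale T \<pi> \<phi> cell s. scale_dist T \<pi> \<phi> cell s w v \<le> 1} | s w.
     0 < s \<and> w \<in> scale T \<pi> \<phi> cell s}"
proof -
  obtain J where J: "\<And>s w v. w \<in> scale T \<pi> \<phi> cell s \<Longrightarrow> v \<in> scale T \<pi> \<phi> cell s \<Longrightarrow> \<bar>lev v - lev w\<bar> \<le> int J"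
    using scale_comparable by blast
  let ?L = "2 * (4 * (A + 1) / r)"
  let ?B = "\<lambda>x k. {v \<in> T. \<bar>lev v - k\<bar> \<le> int J \<and> dist (pos v) x \<le> ?L * sc k}"
  obtain N where N: "\<And>x k. finite (?B x k) \<and> card (?B x k) \<le> N"
    using finite_nearby[of J ?L] by blast
  have "{v \<in> scale T \<pi> \<phi> cell s. scale_dist T \<pi> \<phi> cell s w v \<le> 1} \<subseteq> ?B (pos w) (lev w)"
    if "0 < s" "w \<in> scale T \<pi> \<phi> cell s" for s w
  proof clarify
    fix v assume v: "v \<in> scale T \<pi> \<phi> cell s" "scale_dist T \<pi> \<phi> cell s w v \<le> 1"
    have "graph_dist (scale_edges T \<pi> \<phi> cell s) w v \<le> enat 1"
      using v(2) by (simp add: scale_dist_def one_enat_def)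
    then obtain n where n: "n \<le> 1" "(w, v) \<in> scale_edges T \<pi> \<phi> cell s ^^ n"
      unfolding graph_dist_le_iff by blast
    have "dist (pos w) (pos v) \<le> real (n + 1) * s"
      using scale_chain_dist[OF n(2) that(2)] pos_in_cell scale_diameter(1) that(2) v(1) by blast
    also have "\<dots> \<le> 2 * s"
      using n(1) that(1) by (intro mult_right_mono) auto
    also have "\<dots> \<le> 2 * (4 * (A + 1) / r * sc (lev w))"
      using scale_diameter[OF that(2)] diameter_parent_le[of w] by linarith
    also have "\<dots> = ?L * sc (lev w)"
      by (simp only: mult.assoc)
    finally have "dist (pos v) (pos w) \<le> ?L * sc (lev w)"
      by (simp only: dist_commute)
    then show "v \<in> T \<and> \<bar>lev v - lev w\<bar> \<le> int J \<and> dist (pos v) (pos w) \<le> ?L * sc (lev w)"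
      using scale_diameter(1)[OF v(1)] J[OF that(2) v(1)] by blast
  qed
  note sub = this
  show ?thesis
    unfolding uniformly_finite_def
  proof (intro exI[of _ N] ballI, clarify)
    fix s w assume "0 < s" "w \<in> scale T \<pi> \<phi> cell s"
    then show "finite {v \<in> scale T \<pi> \<phi> cell s. scale_dist T \<pi> \<phi> cell s w v \<le> 1} \<and>
        card {v \<in> scale T \<pi> \<phi> cell s. scale_dist T \<pi> \<phi> cell s w v \<le> 1} \<le> N"
      using sub N[of "lev w" "pos w"] by (meson card_mono finite_subset order_trans)
  qed
qed

lemma diameter_comparable:
  "\<exists>\<eta>>0. \<exists>r. 0 < r \<and> r < 1 \<and> (\<forall>w\<in>T.
        inverse \<eta> * r powi level \<pi> \<phi> w \<le> diameter (cell w) \<and>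
        diameter (cell w) \<le> \<eta> * r powi level \<pi> \<phi> w)"
proof (intro exI conjI ballI)
  define \<eta> where "\<eta> = max (4 * (A + 1) * sc 0) (inverse (c / (8 * \<gamma>) * sc 0))"
  have "0 < c / (8 * \<gamma>) * sc 0"
    using c_pos gamma sc_pos[of 0] by simp
  then show "0 < \<eta>"
    unfolding \<eta>_def by (intro less_le_trans[OF _ max.cobounded2]) (rule positive_imp_inverse_positive)
  have inv: "inverse \<eta> \<le> c / (8 * \<gamma>) * sc 0"
    using \<open>0 < c / (8 * \<gamma>) * sc 0\<close> unfolding \<eta>_def
    by (metis inverse_inverse_eq le_imp_inverse_le max.cobounded2 positive_imp_inverse_positive)
  show "0 < r" "r < 1"
    using r_pos r_small by auto
  fix w assume w: "w \<in> T"
  have p: "0 < r powi lev w"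
    using r_pos by simp
  have "inverse \<eta> * r powi lev w \<le> c / (8 * \<gamma>) * sc 0 * r powi lev w"
    using inv p by (intro mult_right_mono) auto
  then show "inverse \<eta> * r powi level \<pi> \<phi> w \<le> diameter (cell w)"
    using diameter_cell_ge[OF w] sc_powi[of "lev w"] by (simp add: level_eq[OF w] mult.assoc)
  have "4 * (A + 1) * sc 0 * r powi lev w \<le> \<eta> * r powi lev w"
    using p unfolding \<eta>_def by (intro mult_right_mono) auto
  then show "diameter (cell w) \<le> \<eta> * r powi level \<pi> \<phi> w"
    using diameter_cell_le[OF w] sc_powi[of "lev w"] by (simp add: level_eq[OF w] mult.assoc)
qed

lemma finite_neighbourhood:
  assumes "w \<in> T"
  shows "\<exists>U. open U \<and> cell w \<subseteq> U \<and> finite {v \<in> {v \<in> T. lev v = lev w}. U \<inter> cell v \<noteq> {}}"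
proof (intro exI conjI)
  define R where "R = 2 * (A + 1) + 1"
  have near: "dist (pos v) x < R * sc (lev w)" if "lev v = lev w" "x \<in> cell v" for v x
  proof -
    have "dist (pos v) x \<le> 2 * (A + 1) * sc (lev w)"
      using dist_cell_le[OF that(2)] that(1) by simp
    also have "\<dots> < R * sc (lev w)"
      using sc_pos[of "lev w"] by (intro mult_strict_right_mono) (auto simp: R_def)
    finally show ?thesis .
  qed
  let ?U = "ball (pos w) (R * sc (lev w))"
  show "open ?U" by simp
  show "cell w \<subseteq> ?U"
    using near by auto
  have "{v \<in> {v \<in> T. lev v = lev w}. ?U \<inter> cell v \<noteq> {}} \<subseteq>
      {v \<in> T. \<bar>lev v - lev w\<bar> \<le> int 0 \<and> dist (pos v) (pos w) \<le> (2 * R) * sc (lev w)}"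
  proof
    fix v assume "v \<in> {v \<in> {v \<in> T. lev v = lev w}. ?U \<inter> cell v \<noteq> {}}"
    then have v: "v \<in> T" "lev v = lev w" "?U \<inter> cell v \<noteq> {}" by auto
    then obtain x where x: "dist (pos w) x < R * sc (lev w)" "x \<in> cell v" by auto
    have "dist (pos v) (pos w) \<le> (2 * R) * sc (lev w)"
      using near[OF v(2) x(2)] x(1) dist_triangle2[of "pos v" "pos w" x] by simp
    then show "v \<in> {v \<in> T. \<bar>lev v - lev w\<bar> \<le> int 0 \<and> dist (pos v) (pos w) \<le> (2 * R) * sc (lev w)}"
      using v by simp
  qed
  then show "finite {v \<in> {v \<in> T. lev v = lev w}. ?U \<inter> cell v \<noteq> {}}"
    using finite_nearby[of 0 "2 * R"] by (meson finite_subset)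
qed

lemma framework: "basic_framework T \<pi> \<phi> cell"
  unfolding basic_framework_def level_set_eq
proof (intro conjI ballI)
  show "uniformly_finite {{v \<in> T. \<pi> v = w} |w. w \<in> T}"
    unfolding uniformly_finite_def using finite_children by blast
next
  fix w assume w: "w \<in> T"
  have "pos w \<in> ball (pos w) (c / 2 * sc (lev w))"
    using c_pos sc_pos[of "lev w"] by simp
  then have "pos w \<notin> cell v" if "v \<in> T" "lev v = lev w" "v \<noteq> w" for v
    using cell_disjoint_ball[OF w that(1) that(2)[symmetric] that(3)[symmetric]] by blast
  then show "cell w - (\<Union>v\<in>{v \<in> T. lev v = level \<pi> \<phi> w} - {w}. cell v) \<noteq> {}"
    using pos_in_cell[OF w] by (auto simp: level_eq[OF w])
  show "\<exists>U. open U \<and> cell w \<subseteq> U \<and> finite {v \<in> {v \<in> T. lev v = level \<pi> \<phi> w}. U \<inter> cell v \<noteq> {}}"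
    using finite_neighbourhood[OF w] by (simp add: level_eq[OF w])
qed (rule delta_comparable delta_ball_subset_cell scale_neighbours diameter_comparable)+

end

section \<open>Construction of the tree\<close>

text \<open>Uniform perfectness is used twice: about \<open>w\<close> at radius
  \<open>\<rho>\<close> it gives a point \<open>y\<close> well inside the annulus, with some
  \<open>p\<close> of \<open>Q\<close> nearby; about \<open>p\<close> at radius \<open>2 * t\<close>
  it gives \<open>q\<close>. The hypothesis \<open>r\<close> keeps the displacements below
  \<open>\<rho> / 2\<close>, so both points stay between \<open>\<rho> / 2\<close> and
  \<open>2 * (\<gamma> * \<rho>)\<close>, the radii of the annulus.\<close>

lemma annulus_pair:
  fixes w :: "'a::metric_space"
  assumes "1 < \<gamma>" "0 < s" "0 < r" "r \<le> 1 / 16"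
    and r: "(2 * \<gamma> + 2) * r \<le> (1 / (4 * \<gamma>)) ^ Suc i / 4"
    and cover: "\<And>x. \<exists>q\<in>Q. dist x q < r * s"
    and perfect: "\<And>(x::'a) \<rho>. 0 < \<rho> \<Longrightarrow> \<rho> \<le> s / 8 \<Longrightarrow> \<exists>y. \<rho> \<le> dist x y \<and> dist x y < \<gamma> * \<rho>"
  shows "\<exists>p q. p \<in> Q \<and> q \<in> Q \<and> p \<noteq> q \<and> dist p q \<le> (2 * \<gamma> + 4) * (r * s) \<and>
    (\<forall>x\<in>{p, q}. (1 / (4 * \<gamma>)) ^ Suc i / 4 * s \<le> dist w x \<and> dist w x < (1 / (4 * \<gamma>)) ^ i / 4 * s)"
proof -
  define \<theta> where "\<theta> = 1 / (4 * \<gamma>)"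
  define \<rho> where "\<rho> = \<theta> ^ Suc i / 2 * s"
  define t where "t = r * s"
  have theta: "0 < \<theta>" "\<theta> \<le> 1 / 4" "4 * \<gamma> * \<theta> = 1"
    using \<open>1 < \<gamma>\<close> by (auto simp: \<theta>_def field_simps)
  have "0 < t" "t \<le> 1 / 16 * s"
    using assms(2-4) by (auto simp: t_def intro: mult_right_mono)
  have "\<theta> ^ i \<le> 1"
    using theta by (intro power_le_one) auto
  then have "\<theta> * \<theta> ^ i \<le> 1 / 4 * 1"
    using theta by (intro mult_mono) auto
  then have "\<rho> \<le> 1 / 8 * s"
    using \<open>0 < s\<close> unfolding \<rho>_def by (intro mult_right_mono) auto
  moreover have "0 < \<rho>"
    using theta \<open>0 < s\<close> by (simp add: \<rho>_def)
  ultimately obtain y where y: "\<rho> \<le> dist w y" "dist w y < \<gamma> * \<rho>"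
    using perfect[of \<rho> w] by auto
  obtain p where p: "p \<in> Q" "dist y p < t"
    using cover unfolding t_def by blast
  \<comment> \<open>As \<open>y'\<close> is at least \<open>2 * t\<close> away from
    \<open>p\<close>, a point of \<open>Q\<close> within \<open>t\<close> of \<open>y'\<close>
    differs from \<open>p\<close>.\<close>
  obtain y' where y': "2 * t \<le> dist p y'" "dist p y' < \<gamma> * (2 * t)"
    using perfect[of "2 * t" p] \<open>0 < t\<close> \<open>t \<le> _\<close> by auto
  obtain q where q: "q \<in> Q" "dist y' q < t"
    using cover unfolding t_def by blast
  have "t \<le> \<gamma> * t"
    using \<open>1 < \<gamma>\<close> \<open>0 < t\<close> by simp
  have "(2 * \<gamma> + 2) * t \<le> \<theta> ^ Suc i / 4 * s"
    using mult_right_mono[OF r, of s] \<open>0 < s\<close> by (simp add: t_def \<theta>_def mult.assoc)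
  then have small: "2 * (\<gamma> * t) + 2 * t \<le> \<rho> / 2"
    by (simp add: \<rho>_def algebra_simps)
  have "\<rho> < \<gamma> * \<rho>"
    using \<open>1 < \<gamma>\<close> \<open>0 < \<rho>\<close> by simp
  have "p \<noteq> q"
    using q(2) y'(1) \<open>0 < t\<close> dist_commute[of p y'] by auto
  moreover have pq: "dist p q < 2 * (\<gamma> * t) + t"
    using q(2) y'(2) dist_triangle[of p q y'] by simp
  moreover have "2 * (\<gamma> * t) + t \<le> (2 * \<gamma> + 4) * (r * s)"
    using \<open>0 < t\<close> by (simp add: t_def algebra_simps)
  moreover have "\<rho> / 2 \<le> dist w x \<and> dist w x < 2 * (\<gamma> * \<rho>)" if "x \<in> {p, q}" for x
  proof -
    have "dist y p \<le> 2 * (\<gamma> * t) + 2 * t"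
      using p(2) \<open>0 < t\<close> \<open>t \<le> \<gamma> * t\<close> by linarith
    moreover have "dist y q \<le> 2 * (\<gamma> * t) + 2 * t"
      using pq p(2) dist_triangle[of y q p] \<open>0 < t\<close> by linarith
    ultimately have "dist y x \<le> 2 * (\<gamma> * t) + 2 * t"
      using that by blast
    then show ?thesis
      using y small \<open>\<rho> < \<gamma> * \<rho>\<close> dist_triangle[of w x y] dist_triangle2[of w y x] by linarith
  qed
  moreover have "\<rho> / 2 = \<theta> ^ Suc i / 4 * s"
    by (simp add: \<rho>_def)
  moreover have "2 * (\<gamma> * \<rho>) = \<theta> ^ i / 4 * s"
  proof -
    have "2 * (\<gamma> * \<rho>) = (4 * \<gamma> * \<theta>) * (\<theta> ^ i / 4 * s)"
      by (simp add: \<rho>_def)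
    then show ?thesis
      unfolding theta(3) by simp
  qed
  ultimately show ?thesis
    using p(1) q(1) unfolding \<theta>_def[symmetric] by (metis less_imp_le order_trans)
qed

text \<open>The parent is a default \<open>g\<close>, modified at the points \<open>q w i\<close>
  that are handed over to neighbours. The annuli about all points of \<open>P\<close> are disjoint,
  so no point goes to two neighbours and every \<open>p w i\<close> keeps its default. Since
  \<open>c * s\<close> does not exceed the inner radius of the smallest annulus, so do the points
  near a centre.\<close>

lemma parent_map:
  fixes P Q :: "'a::metric_space set"
  assumes "1 < \<gamma>" "0 < s" "0 < r" "A = 2 * \<gamma> + 4"
    and c: "0 < c" "c \<le> (1 / (4 * \<gamma>)) ^ N / 4" and r: "8 * (A + 1) * r \<le> c"
    and sep: "\<And>w v. w \<in> P \<Longrightarrow> v \<in> P \<Longrightarrow> w \<noteq> v \<Longrightarrow> s \<le> dist w v"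
    and coverP: "\<And>x. \<exists>w\<in>P. dist x w < s" and coverQ: "\<And>x. \<exists>q\<in>Q. dist x q < r * s"
    and card: "\<And>w. w \<in> P \<Longrightarrow> finite {v \<in> P. dist w v \<le> A * s} \<and> card {v \<in> P. dist w v \<le> A * s} \<le> N"
    and perfect: "\<And>(x::'a) \<rho>. 0 < \<rho> \<Longrightarrow> \<rho> \<le> s / 8 \<Longrightarrow> \<exists>y. \<rho> \<le> dist x y \<and> dist x y < \<gamma> * \<rho>"
  shows "\<exists>f. (\<forall>x. f x \<in> P) \<and> (\<forall>x. \<forall>w\<in>P. dist x w < c * s \<longrightarrow> f x = w) \<and>
    (\<forall>x. \<exists>w\<in>P. dist x w \<le> s \<and> dist w (f x) \<le> A * s) \<and>
    (\<forall>w\<in>P. \<forall>v\<in>P. dist w v \<le> A * s \<longrightarrow>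
       (\<exists>w'\<in>Q. \<exists>v'\<in>Q. f w' = w \<and> f v' = v \<and> dist w' v' \<le> A * (r * s)))"
proof -
  define \<theta> where "\<theta> = 1 / (4 * \<gamma>)"
  define nb where "nb w = {v \<in> P. v \<noteq> w \<and> dist w v \<le> A * s}" for w
  \<comment> \<open>Half-open, with the inner radius for \<open>i\<close> equal to the outer radius
    for \<open>Suc i\<close>, so that different indices give disjoint annuli.\<close>
  define ann where "ann w i x \<longleftrightarrow> \<theta> ^ Suc i / 4 * s \<le> dist w x \<and> dist w x < \<theta> ^ i / 4 * s" for w x :: 'a and i
  have theta: "0 < \<theta>" "\<theta> \<le> 1"
    using \<open>1 < \<gamma>\<close> by (auto simp: \<theta>_def field_simps)
  have pow: "\<theta> ^ j \<le> \<theta> ^ i" if "i \<le> j" for i j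
    using theta that by (intro power_decreasing) auto
  have pow_s: "\<theta> ^ j / 4 * s \<le> \<theta> ^ i / 4 * s" if "i \<le> j" for i j
    using pow[OF that] \<open>0 < s\<close> by (intro mult_right_mono) auto
  have cs: "c * s \<le> \<theta> ^ N / 4 * s"
    using c \<open>0 < s\<close> unfolding \<theta>_def by (intro mult_right_mono) auto
  then have cs4: "c * s \<le> 1 / 4 * s"
    using pow_s[of 0 N] by simp
  have "A > 0" using \<open>1 < \<gamma>\<close> \<open>A = _\<close> by simp
  have "2 * \<gamma> + 2 \<le> 8 * (A + 1)"
    using \<open>1 < \<gamma>\<close> \<open>A = _\<close> by simp
  from mult_right_mono[OF this, of r] have r_ann: "(2 * \<gamma> + 2) * r \<le> \<theta> ^ N / 4"
    using r c(2) \<open>0 < r\<close> unfolding \<theta>_def by linarith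
  have "8 * 5 * r \<le> 8 * (A + 1) * r"
    using \<open>1 < \<gamma>\<close> \<open>A = _\<close> \<open>0 < r\<close> by (intro mult_right_mono) auto
  then have "8 * 5 * r \<le> c"
    using r by (rule order_trans)
  moreover have "c \<le> 1 / 4"
    using c(2) pow[of 0 N] unfolding \<theta>_def[symmetric] by simp
  ultimately have r_le: "r \<le> c" "r \<le> 1 / 16"
    using \<open>0 < r\<close> by auto
  have annD: "dist w x < 1 / 4 * s" if "ann w i x" for w x i
    using that pow_s[of 0 i] by (auto simp: ann_def)

  \<comment> \<open>If \<open>v\<close> is the \<open>i\<close>-th neighbour of \<open>w\<close>, then \<open>p w i\<close> will be a child of \<open>w\<close> and \<open>q w i\<close> a child of \<open>v\<close>.\<close>
  have "\<exists>p q. p \<in> Q \<and> q \<in> Q \<and> p \<noteq> q \<and> dist p q \<le> A * (r * s) \<and> ann w i p \<and> ann w i q"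
    if "i < N" for w :: 'a and i
  proof -
    have "(2 * \<gamma> + 2) * r \<le> (1 / (4 * \<gamma>)) ^ Suc i / 4"
      using r_ann pow[of "Suc i" N] that unfolding \<theta>_def by linarith
    from annulus_pair[OF \<open>1 < \<gamma>\<close> \<open>0 < s\<close> \<open>0 < r\<close> r_le(2) this coverQ perfect, of w]
    show ?thesis
      unfolding ann_def \<open>A = _\<close> \<theta>_def by blast
  qed
  then have "\<forall>w i. \<exists>p q. i < N \<longrightarrow> p \<in> Q \<and> q \<in> Q \<and> p \<noteq> q \<and> dist p q \<le> A * (r * s) \<and>
      ann w i p \<and> ann w i q"
    by meson
  then obtain p q where pq: "\<And>(w::'a) i. i < N \<Longrightarrow> p w i \<in> Q \<and> q w i \<in> Q \<and> p w i \<noteq> q w i \<and>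
      dist (p w i) (q w i) \<le> A * (r * s) \<and> ann w i (p w i) \<and> ann w i (q w i)"
    by metis

  \<comment> \<open>An injective numbering reserves a separate annulus for each neighbour of
    \<open>w\<close>.\<close>
  have "\<exists>\<iota>. inj_on \<iota> (nb w) \<and> \<iota> ` nb w \<subseteq> {..<N}" if "w \<in> P" for w
  proof -
    have sub: "nb w \<subseteq> {v \<in> P. dist w v \<le> A * s}"
      by (auto simp: nb_def)
    have fin: "finite (nb w)" "card (nb w) \<le> N"
      using finite_subset[OF sub] card_mono[OF _ sub] card[OF that] by auto
    obtain \<iota> where "bij_betw \<iota> (nb w) {0..<card (nb w)}"
      using ex_bij_betw_finite_nat[OF fin(1)] by blast
    then show ?thesis
      using fin(2) by (intro exI[of _ \<iota>]) (auto simp: bij_betw_def)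
  qed
  then obtain \<iota> where iota: "\<And>w. w \<in> P \<Longrightarrow> inj_on (\<iota> w) (nb w)"
      "\<And>w v. w \<in> P \<Longrightarrow> v \<in> nb w \<Longrightarrow> \<iota> w v < N"
    by (metis image_subset_iff lessThan_iff)

  have close: "w = w'" if "w \<in> P" "w' \<in> P" "dist x w < s / 2" "dist x w' < s / 2" for w w' x
    using sep[OF that(1,2)] that(3,4) dist_triangle_half_r[of x w s w'] by fastforce
  \<comment> \<open>The default parent: the centre within \<open>s / 2\<close> if there is one,
    which is unique, and otherwise any centre within \<open>s\<close>. Points of an annulus are
    within \<open>s / 4\<close> of its centre and default to it.\<close>
  have "\<exists>w. w \<in> P \<and> dist x w < s \<and> (\<forall>w'\<in>P. dist x w' < s / 2 \<longrightarrow> w = w')" for x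
  proof (cases "\<exists>w\<in>P. dist x w < s / 2")
    case True
    then obtain w where "w \<in> P" "dist x w < s / 2" by blast
    moreover from this have "\<forall>w'\<in>P. dist x w' < s / 2 \<longrightarrow> w = w'"
      using close[of w _ x] by blast
    moreover have "s / 2 < s"
      using \<open>0 < s\<close> by simp
    ultimately show ?thesis
      by (meson order_less_trans)
  next
    case False
    then show ?thesis
      using coverP[of x] by blast
  qed
  then obtain g where g: "\<And>x. g x \<in> P" "\<And>x. dist x (g x) < s"
      "\<And>x w. w \<in> P \<Longrightarrow> dist x w < s / 2 \<Longrightarrow> g x = w"
    by metis

  have ann_unique: "w = w' \<and> i = i'" if "w \<in> P" "w' \<in> P" "ann w i x" "ann w' i' x" for w w' i i' x
  proof -
    have "dist x w < s / 2" "dist x w' < s / 2"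
      using annD[OF that(3)] annD[OF that(4)] \<open>0 < s\<close> by (auto simp: dist_commute)
    then have "w = w'"
      using close that(1,2) by blast
    moreover have False if "j < l" "ann w j x" "ann w l x" for j l
      using that pow_s[of "Suc j" l] unfolding ann_def by linarith
    ultimately show ?thesis
      using that by (metis linorder_neqE_nat)
  qed

  define stolen where "stolen x v \<longleftrightarrow> (\<exists>w\<in>P. v \<in> nb w \<and> x = q w (\<iota> w v))" for x v
  define f where "f x = (if \<exists>v. stolen x v then SOME v. stolen x v else g x)" for x
  have stolen_unique: "v = v'" if "stolen x v" "stolen x v'" for x v v'
  proof -
    obtain w w' where w: "w \<in> P" "v \<in> nb w" "x = q w (\<iota> w v)" "w' \<in> P" "v' \<in> nb w'" "x = q w' (\<iota> w' v')"
      using \<open>stolen x v\<close> \<open>stolen x v'\<close> by (auto simp: stolen_def)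
    then have "w = w' \<and> \<iota> w v = \<iota> w' v'"
      using iota(2) pq by (intro ann_unique[of w w' _ x]) metis+
    then show ?thesis
      using w iota(1)[of w] by (auto dest: inj_onD)
  qed
  have f_stolen: "f x = v" if "stolen x v" for x v
    using stolen_unique that unfolding f_def by (metis someI_ex)
  have f_g: "f x = g x" if "\<not> (\<exists>v. stolen x v)" for x
    using that by (simp add: f_def)
  have stolenE: "\<exists>w i. w \<in> P \<and> v \<in> nb w \<and> i < N \<and> x = q w i \<and> ann w i x" if "stolen x v" for x v
    using that iota(2) pq unfolding stolen_def by metis
  have f_p: "f (p w i) = w" if "w \<in> P" "i < N" for w i
  proof -
    have "\<not> stolen (p w i) v" for v
    proof
      assume "stolen (p w i) v"
      then obtain w' i' where *: "w' \<in> P" "i' < N" "p w i = q w' i'" "ann w' i' (p w i)"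
        using stolenE by blast
      have "w = w' \<and> i = i'"
        using *(1,4) pq[OF that(2), of w] that(1) by (intro ann_unique[of w w' i "p w i" i']) blast+
      then show False
        using * pq[OF that(2)] by metis
    qed
    then have "f (p w i) = g (p w i)"
      using f_g by blast
    also have "\<dots> = w"
      using annD[of w i "p w i"] pq[OF that(2)] that(1) \<open>0 < s\<close> by (intro g(3)) (auto simp: dist_commute)
    finally show ?thesis .
  qed
  have inner: "f x = w" if "w \<in> P" "dist x w < c * s" for x w
  proof -
    have "dist x w < s / 2"
      using that(2) cs4 \<open>0 < s\<close> by linarith
    have "\<not> stolen x v" for v
    proof
      assume "stolen x v"
      then obtain w' i where *: "w' \<in> P" "i < N" "ann w' i x"
        using stolenE by blast
      then have "w' = w"
        using close[OF *(1) that(1), of x] annD[OF *(3)] \<open>dist x w < s / 2\<close> \<open>0 < s\<close> by (simp add: dist_commute)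
      then show False
        using * pow_s[of "Suc i" N] cs that(2) dist_commute[of x w] unfolding ann_def by simp
    qed
    then show ?thesis
      using f_g g(3)[OF that(1) \<open>dist x w < s / 2\<close>] by simp
  qed
  \<comment> \<open>For a stolen point the required \<open>w\<close> is the centre of its annulus,
    whose neighbour is the new parent; otherwise it is the parent itself.\<close>
  moreover have "f x \<in> P \<and> (\<exists>w\<in>P. dist x w \<le> s \<and> dist w (f x) \<le> A * s)" for x
  proof (cases "\<exists>v. stolen x v")
    case True
    then obtain v where "stolen x v" by blast
    then obtain w i where *: "w \<in> P" "v \<in> nb w" "ann w i x"
      using stolenE by blast
    then have "dist x w \<le> s"
      using annD[OF *(3)] \<open>0 < s\<close> by (simp add: dist_commute)
    then show ?thesis
      using f_stolen[OF \<open>stolen x v\<close>] * by (auto simp: nb_def)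
  next
    case False
    then show ?thesis
      using f_g[OF False] g(1,2)[of x] \<open>0 < A\<close> \<open>0 < s\<close> by (auto intro!: bexI[of _ "g x"])
  qed
  moreover have "\<exists>w'\<in>Q. \<exists>v'\<in>Q. f w' = w \<and> f v' = v \<and> dist w' v' \<le> A * (r * s)"
    if "w \<in> P" "v \<in> P" "dist w v \<le> A * s" for w v
  proof (cases "w = v")
    case True
    obtain x where x: "x \<in> Q" "dist w x < r * s"
      using coverQ by blast
    have "r * s \<le> c * s"
      using r_le(1) \<open>0 < s\<close> by simp
    then have "f x = w"
      using that(1) x(2) by (intro inner) (auto simp: dist_commute)
    then show ?thesis
      using x(1) True \<open>0 < A\<close> \<open>0 < r\<close> \<open>0 < s\<close> by (intro bexI[of _ x]) auto
  next
    case False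
    then have "v \<in> nb w"
      using that by (simp add: nb_def)
    define i where "i = \<iota> w v"
    have "i < N"
      using iota(2)[OF that(1) \<open>v \<in> nb w\<close>] by (simp add: i_def)
    have "stolen (q w i) v"
      using that(1) \<open>v \<in> nb w\<close> by (auto simp: stolen_def i_def)
    then show ?thesis
      using f_p[OF that(1) \<open>i < N\<close>] f_stolen pq[OF \<open>i < N\<close>] by blast
  qed
  ultimately show ?thesis
    by (intro exI[of _ f]) blast
qed

section \<open>Choice of constants and assembly of the tree\<close>

lemma countable_separated:
  fixes S :: "'a::metric_space set"
  assumes "doubling_space TYPE('a)" "0 < s" "\<And>y z. y \<in> S \<Longrightarrow> z \<in> S \<Longrightarrow> y \<noteq> z \<Longrightarrow> s \<le> dist y z"
  shows "countable S"
proof (cases "S = {}")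
  case False
  then obtain x where "x \<in> S" by blast
  have "finite (S \<inter> cball x (real n))" for n
  proof -
    obtain N where N: "\<forall>(x::'a) t S. 0 < t \<longrightarrow> S \<subseteq> cball x (real n / s * t) \<longrightarrow>
           (\<forall>y\<in>S. \<forall>z\<in>S. y \<noteq> z \<longrightarrow> t \<le> dist y z) \<longrightarrow> finite S \<and> card S \<le> N"
      using doubling_separated_card[OF assms(1), of "real n / s"] by (rule exE)
    have "S \<inter> cball x (real n) \<subseteq> cball x (real n / s * s)"
      using assms(2) by simp
    then show ?thesis
      using N[rule_format, OF assms(2), of "S \<inter> cball x (real n)" x] assms(3) by blast
  qed
  moreover have "S \<subseteq> (\<Union>n. S \<inter> cball x (real n))"
    using real_arch_simple by auto
  ultimately show ?thesis
    by (meson countable_UN countable_finite countable_subset countableI_type)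
qed simp

text \<open>The tree is built on pairs of a level and a point; an encoding \<open>h\<close> with
  left inverse \<open>g\<close> on \<open>T\<close> carries it to another type, here the natural
  numbers in the end.\<close>

lemma net_tree_transport:
  assumes "net_tree T \<pi> \<phi> lev pos rooted sc r A c \<gamma>" and gh: "\<And>z. z \<in> T \<Longrightarrow> g (h z) = z"
  shows "net_tree (h ` T) (h \<circ> \<pi> \<circ> g) (h \<phi>) (lev \<circ> g) (pos \<circ> g) rooted sc r A c \<gamma>"
proof -
  interpret net_tree T \<pi> \<phi> lev pos rooted sc r A c \<gamma> by fact
  have [simp]: "g (h z) = z" "\<pi> z \<in> T" if "z \<in> T" for z
    using that gh pi_in by auto
  show ?thesis
  proof
    show "countable (h ` T)"
      using countable_T by simp
    show "\<exists>w'\<in>h ` T. \<exists>v'\<in>h ` T. (h \<circ> \<pi> \<circ> g) w' = w \<and> (h \<circ> \<pi> \<circ> g) v' = v \<and>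
        (lev \<circ> g) w' = (lev \<circ> g) w + 1 \<and> (lev \<circ> g) v' = (lev \<circ> g) w + 1 \<and>
        dist ((pos \<circ> g) w') ((pos \<circ> g) v') \<le> A * sc ((lev \<circ> g) w + 1)"
      if "w \<in> h ` T" "v \<in> h ` T" "(lev \<circ> g) w = (lev \<circ> g) v"
        "dist ((pos \<circ> g) w) ((pos \<circ> g) v) \<le> A * sc ((lev \<circ> g) w)" for w v
    proof -
      note hyps = that
      obtain z y where "z \<in> T" "y \<in> T" "w = h z" "v = h y"
        using hyps(1,2) by blast
      then obtain z' y' where "z' \<in> T" "y' \<in> T" "\<pi> z' = z" "\<pi> y' = y" "lev z' = lev z + 1"
         "lev y' = lev z + 1" "dist (pos z') (pos y') \<le> A * sc (lev z + 1)"
        using split[of z y] hyps by auto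
      then show ?thesis
        using \<open>w = h z\<close> \<open>v = h y\<close> \<open>z \<in> T\<close> by (intro bexI[of _ "h z'"] bexI[of _ "h y'"]) auto
    qed
    show "\<exists>w\<in>h ` T. (lev \<circ> g) w = (lev \<circ> g) v - 1 \<and> dist ((pos \<circ> g) v) ((pos \<circ> g) w) \<le> sc ((lev \<circ> g) w) \<and>
        dist ((pos \<circ> g) w) ((pos \<circ> g) ((h \<circ> \<pi> \<circ> g) v)) \<le> A * sc ((lev \<circ> g) w)"
      if "v \<in> h ` T" "(lev \<circ> g) ((h \<circ> \<pi> \<circ> g) v) = (lev \<circ> g) v - 1" for v
    proof -
      note hyps = that
      obtain y where y: "y \<in> T" "v = h y"
        using hyps(1) by blast
      then obtain z where "z \<in> T" "lev z = lev y - 1" "dist (pos y) (pos z) \<le> sc (lev z)"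
          "dist (pos z) (pos (\<pi> y)) \<le> A * sc (lev z)"
        using near[of y] hyps by auto
      then show ?thesis
        using y by (intro bexI[of _ "h z"]) auto
    qed
    show "(h \<circ> \<pi> \<circ> g) v = w"
      if "w \<in> h ` T" "v \<in> h ` T" "(lev \<circ> g) v = (lev \<circ> g) w + 1"
        "dist ((pos \<circ> g) v) ((pos \<circ> g) w) < c * sc ((lev \<circ> g) w)" for w v
      using that inner by auto
    show "sc ((lev \<circ> g) w) \<le> dist ((pos \<circ> g) w) ((pos \<circ> g) v)"
      if "w \<in> h ` T" "v \<in> h ` T" "(lev \<circ> g) w = (lev \<circ> g) v" "w \<noteq> v" for w v
    proof -
      have "g w \<noteq> g v"
        using that(1,2,4) gh by (metis imageE)
      then show ?thesis
        using that(1-3) separated[of "g w" "g v"] by auto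
    qed
    show "\<exists>w\<in>h ` T. (lev \<circ> g) w = k \<and> dist x ((pos \<circ> g) w) < sc k" if "rooted \<Longrightarrow> 0 \<le> k" for k x
      using covering[OF that, of x] by auto
    show "\<exists>w\<in>h ` T. (lev \<circ> g) w = k \<and> (pos \<circ> g) w = (pos \<circ> g) (h \<phi>)" if "\<not> rooted" for k
      using base_point[OF that, of k] root_in by auto
    show "w = h \<phi>" if "rooted" "w \<in> h ` T" "(lev \<circ> g) w = 0" for w
      using that lev_0 by auto
    show "\<exists>y. \<rho> \<le> dist x y \<and> dist x y < \<gamma> * \<rho>" if "rooted \<Longrightarrow> 0 \<le> k" "0 < \<rho>" "\<rho> \<le> sc k / 8" for k \<rho> and x :: 'b
      using perfect[OF that] .
  qed (use complete doubling not_isolated sc_pos sc_step r_pos A_ge c_pos c_le r_le gamma small root_in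
      lev_root lev_pi lev_nonneg in auto)
qed

text \<open>The constants are chosen in the order \<open>A\<close>, \<open>n\<close>,
  \<open>c\<close>, \<open>r\<close>, \<open>sc\<close>. There is no circularity: \<open>n\<close>
  bounds the number of neighbours, hence of annuli needed, and does not depend on
  \<open>r\<close>.\<close>

lemma net_tree_exists:
  assumes complete: "complete (UNIV :: 'a::metric_space set)" and doubling: "doubling_space TYPE('a)"
    and not_isolated: "no_isolated_points TYPE('a)"
    and "1 < \<gamma>" "0 < a"
    and perfect: "\<And>(x::'a) \<rho>. 0 < \<rho> \<Longrightarrow> (rooted \<Longrightarrow> \<rho> \<le> a / 8) \<Longrightarrow> \<exists>y. \<rho> \<le> dist x y \<and> dist x y < \<gamma> * \<rho>"
    and small: "\<And>x y :: 'a. rooted \<Longrightarrow> dist x y < a"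
  shows "\<exists>(T :: (int \<times> 'a) set) \<pi> \<phi> sc r A c. net_tree T \<pi> \<phi> fst snd rooted sc r A c \<gamma>"
proof -
  define A where "A = 2 * \<gamma> + 4"
  obtain n where n: "\<forall>(x::'a) s S. 0 < s \<longrightarrow> S \<subseteq> cball x (A * s) \<longrightarrow>
      (\<forall>y\<in>S. \<forall>z\<in>S. y \<noteq> z \<longrightarrow> s \<le> dist y z) \<longrightarrow> finite S \<and> card S \<le> n"
    using doubling_separated_card[OF doubling, of A] by (rule exE)
  \<comment> \<open>The inner radius of the last of \<open>n\<close> annuli, relative to the
    scale.\<close>
  define c where "c = (1 / (4 * \<gamma>)) ^ n / 4"
  define r where "r = c / (8 * (A + 1))"
  define sc where "sc k = a * r powi k" for k
  have "4 \<le> A" using \<open>1 < \<gamma>\<close> by (simp add: A_def)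
  have c: "0 < c" "c \<le> 1 / 4"
    using \<open>1 < \<gamma>\<close> by (auto simp: c_def power_le_one)
  have r: "0 < r" "8 * (A + 1) * r \<le> c"
    using \<open>4 \<le> A\<close> c by (auto simp: r_def)
  have "8 * (4 + 1) * r \<le> 8 * (A + 1) * r"
    using \<open>4 \<le> A\<close> r(1) by (intro mult_right_mono) auto
  then have "8 * (4 + 1) * r \<le> 1 / 4"
    using r(2) c(2) by (meson order_trans)
  then have "r \<le> 1"
    by simp
  have sc_pos: "0 < sc k" for k
    using \<open>0 < a\<close> r(1) by (simp add: sc_def)
  have sc_step: "sc (k + 1) = r * sc k" for k
    using r(1) by (simp add: sc_def power_int_add_1)
  have sc_0: "sc 0 = a"
    by (simp add: sc_def)
  have sc_le: "sc k \<le> a" if "0 \<le> k" for k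
    using that r(1) \<open>r \<le> 1\<close> \<open>0 < a\<close> by (simp add: sc_def mult_left_le power_int_le_one)
  have perfect': "\<exists>y. \<rho> \<le> dist x y \<and> dist x y < \<gamma> * \<rho>"
    if "rooted \<Longrightarrow> 0 \<le> k" "0 < \<rho>" "\<rho> \<le> sc k / 8" for k \<rho> and x :: 'a
    using that sc_le[of k] by (intro perfect) auto
  obtain x0 :: 'a where True by simp
  obtain N where N: "\<And>k. x0 \<in> N k" "\<And>k y z. y \<in> N k \<Longrightarrow> z \<in> N k \<Longrightarrow> y \<noteq> z \<Longrightarrow> sc k \<le> dist y z"
      "\<And>k x. \<exists>y\<in>N k. dist x y < sc k"
    using maximal_separated_set[OF sc_pos, of x0] by metis
  have card: "finite {v \<in> N k. dist w v \<le> A * sc k} \<and> card {v \<in> N k. dist w v \<le> A * sc k} \<le> n" for k w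
    by (rule n[rule_format, OF sc_pos[of k], of _ w]) (auto intro: N(2))
  define good where "good k f \<longleftrightarrow>
    (\<forall>x. f x \<in> N k) \<and> (\<forall>x. \<forall>w\<in>N k. dist x w < c * sc k \<longrightarrow> f x = w) \<and>
    (\<forall>x. \<exists>w\<in>N k. dist x w \<le> sc k \<and> dist w (f x) \<le> A * sc k) \<and>
    (\<forall>w\<in>N k. \<forall>v\<in>N k. dist w v \<le> A * sc k \<longrightarrow>
       (\<exists>w'\<in>N (k + 1). \<exists>v'\<in>N (k + 1). f w' = w \<and> f v' = v \<and> dist w' v' \<le> A * sc (k + 1)))" for k f
  have "\<exists>f. good k f"
    if k: "rooted \<longrightarrow> 0 \<le> k" for k
    unfolding good_def sc_step
  proof (rule parent_map[OF \<open>1 < \<gamma>\<close> sc_pos r(1) A_def c(1) _ r(2)])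
    show "c \<le> (1 / (4 * \<gamma>)) ^ n / 4"
      by (simp add: c_def)
    show "\<exists>q\<in>N (k + 1). dist x q < r * sc k" for x
      using N(3)[of "k + 1" x] by (simp add: sc_step)
    show "\<exists>y. \<rho> \<le> dist x y \<and> dist x y < \<gamma> * \<rho>" if "0 < \<rho>" "\<rho> \<le> sc k / 8" for x :: 'a and \<rho>
      using that k by (intro perfect'[of k]) auto
  qed (use N card in auto)
  then have "\<forall>k. \<exists>f. (rooted \<longrightarrow> 0 \<le> k) \<longrightarrow> good k f"
    by blast
  then obtain f where f: "\<forall>k. (rooted \<longrightarrow> 0 \<le> k) \<longrightarrow> good k (f k)"
    by (rule choice[THEN exE])
  have f: "f k x \<in> N k"
    "w \<in> N k \<Longrightarrow> dist x w < c * sc k \<Longrightarrow> f k x = w"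
    "\<exists>w\<in>N k. dist x w \<le> sc k \<and> dist w (f k x) \<le> A * sc k"
    "w \<in> N k \<Longrightarrow> v \<in> N k \<Longrightarrow> dist w v \<le> A * sc k \<Longrightarrow>
       \<exists>w'\<in>N (k + 1). \<exists>v'\<in>N (k + 1). f k w' = w \<and> f k v' = v \<and> dist w' v' \<le> A * sc (k + 1)"
    if "rooted \<longrightarrow> 0 \<le> k" for k x w v
    using f[rule_format, OF that[rule_format]] unfolding good_def by blast+
  \<comment> \<open>In the rooted case \<open>sc 0 = a\<close> exceeds every distance, so a
    separated set at this scale is a single point.\<close>
  have N0: "x = x0" if "rooted" "x \<in> N 0" for x
    using N(2)[OF that(2) N(1)] small[OF that(1), of x x0] sc_0 by fastforce
  \<comment> \<open>The level is kept in the vertex because a point may belong to several nets, as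
    \<open>x0\<close> belongs to all.\<close>
  define T where "T = {(k, x). (rooted \<longrightarrow> 0 \<le> k) \<and> x \<in> N k}"
  define \<pi> where "\<pi> = (\<lambda>(k, x). if rooted \<and> k = 0 then (k, x) else (k - 1, f (k - 1) x))"
  have [simp]: "(k, x) \<in> T \<longleftrightarrow> (rooted \<longrightarrow> 0 \<le> k) \<and> x \<in> N k" for k x
    by (simp add: T_def)
  have [simp]: "\<pi> (k, x) = (if rooted \<and> k = 0 then (k, x) else (k - 1, f (k - 1) x))" for k x
    by (simp add: \<pi>_def)
  have "net_tree T \<pi> (0, x0) fst snd rooted sc r A c \<gamma>"
  proof
    have "countable (N k)" for k
      by (rule countable_separated[OF doubling sc_pos[of k] N(2)])
    then have "countable (SIGMA k:UNIV. N k)"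
      by (intro countable_SIGMA) auto
    then show "countable T"
      by (rule countable_subset[rotated]) (auto simp: T_def)
    show "\<exists>y. \<rho> \<le> dist x y \<and> dist x y < \<gamma> * \<rho>"
      if "rooted \<Longrightarrow> 0 \<le> k" "0 < \<rho>" "\<rho> \<le> sc k / 8" for k \<rho> and x :: 'a
      using perfect'[OF that] .
    show "\<pi> w \<in> T" if "w \<in> T" for w
      using that by (cases w) (auto intro!: f(1))
    show "fst (\<pi> w) = (if rooted then max 0 (fst w - 1) else fst w - 1)" if "w \<in> T" for w
      using that by (cases w) auto
    show "w = (0, x0)" if "rooted" "w \<in> T" "fst w = 0" for w
      using that N0 by (cases w) auto
    show "sc (fst w) \<le> dist (snd w) (snd v)" if "w \<in> T" "v \<in> T" "fst w = fst v" "w \<noteq> v" for w v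
      using that N(2) by (cases w; cases v) auto
    show "\<exists>w\<in>T. fst w = k \<and> dist x (snd w) < sc k" if "rooted \<Longrightarrow> 0 \<le> k" for k x
    proof -
      obtain y where "y \<in> N k" "dist x y < sc k"
        using N(3) by blast
      then show ?thesis
        using that by (intro bexI[of _ "(k, y)"]) auto
    qed
    show "\<exists>w\<in>T. fst w = k \<and> snd w = snd (0::int, x0)" if "\<not> rooted" for k
      using that N(1) by (intro bexI[of _ "(k, x0)"]) auto
    show "\<pi> v = w" if "w \<in> T" "v \<in> T" "fst v = fst w + 1" "dist (snd v) (snd w) < c * sc (fst w)" for w v
      using that f(2) by (cases w; cases v) auto
    show "\<exists>w\<in>T. fst w = fst v - 1 \<and> dist (snd v) (snd w) \<le> sc (fst w) \<and>
        dist (snd w) (snd (\<pi> v)) \<le> A * sc (fst w)"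
      if "v \<in> T" "fst (\<pi> v) = fst v - 1" for v
    proof -
      obtain k x where v: "v = (k, x)" by (cases v)
      then have k: "rooted \<longrightarrow> 0 \<le> k - 1" "\<not> (rooted \<and> k = 0)"
        using that by (auto split: if_splits)
      then obtain w where "w \<in> N (k - 1)" "dist x w \<le> sc (k - 1)" "dist w (f (k - 1) x) \<le> A * sc (k - 1)"
        using f(3) by blast
      then show ?thesis
        using v k by (intro bexI[of _ "(k - 1, w)"]) auto
    qed
    show "\<exists>w'\<in>T. \<exists>v'\<in>T. \<pi> w' = w \<and> \<pi> v' = v \<and> fst w' = fst w + 1 \<and> fst v' = fst w + 1 \<and>
        dist (snd w') (snd v') \<le> A * sc (fst w + 1)"
      if "w \<in> T" "v \<in> T" "fst w = fst v" "dist (snd w) (snd v) \<le> A * sc (fst w)" for w v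
    proof -
      note hyps = that
      obtain k x y where wv: "w = (k, x)" "v = (k, y)"
        using hyps(3) by (cases w; cases v) auto
      then have k: "rooted \<longrightarrow> 0 \<le> k" and "x \<in> N k" "y \<in> N k" "dist x y \<le> A * sc k"
        using hyps by auto
      then obtain x' y' where "x' \<in> N (k + 1)" "y' \<in> N (k + 1)" "f k x' = x" "f k y' = y"
          "dist x' y' \<le> A * sc (k + 1)"
        using f(4) by blast
      then show ?thesis
        using wv k by (intro bexI[of _ "(k + 1, x')"] bexI[of _ "(k + 1, y')"]) auto
    qed
  qed (use complete doubling not_isolated sc_pos sc_step r c \<open>4 \<le> A\<close> \<open>1 < \<gamma>\<close> small N(1) in
      \<open>auto simp: sc_0 T_def\<close>)
  then show ?thesis by blast
qed

text \<open>In the bounded case \<open>a\<close> is twice the diameter, which is positive as the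
  absence of isolated points provides two points. A ball of radius at most \<open>a / 8\<close> then
  has at most half the diameter of the space. In the unbounded case no ball is the whole
  space.\<close>

lemma proper_ball_radius:
  assumes "no_isolated_points TYPE('a::metric_space)"
  shows "\<exists>a>0. (bounded (UNIV :: 'a set) \<longrightarrow> (\<forall>x y :: 'a. dist x y < a)) \<and>
     (\<forall>(x::'a) \<rho>. (bounded (UNIV :: 'a set) \<longrightarrow> \<rho> \<le> a / 8) \<longrightarrow> ball x \<rho> \<noteq> UNIV)"
proof (cases "bounded (UNIV :: 'a set)")
  case True
  let ?D = "diameter (UNIV :: 'a set)"
  have D: "dist x y \<le> ?D" for x y :: 'a
    using diameter_bounded_bound[OF True] by simp
  obtain x :: 'a where True by simp
  have "\<not> (x isolated_in UNIV)"
    using assms by (simp add: no_isolated_points_def)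
  then have "\<not> open {x}"
    by (simp add: isolated_in_def)
  then have "UNIV \<noteq> {x}"
    using open_UNIV by metis
  then obtain y where "y \<noteq> x" by blast
  then have "0 < ?D"
    using D[of y x] by (meson less_le_trans zero_less_dist_iff)
  have "ball z \<rho> \<noteq> UNIV" if "\<rho> \<le> 2 * ?D / 8" for z :: 'a and \<rho>
  proof
    assume "ball z \<rho> = UNIV"
    then have *: "dist z u < \<rho>" for u
      by (metis UNIV_I mem_ball)
    have "dist u v \<le> 2 * \<rho>" for u v :: 'a
      using *[of u] *[of v] dist_triangle3[of u v z] by linarith
    then have "?D \<le> 2 * \<rho>"
      by (intro diameter_leI) auto
    then show False
      using that \<open>0 < ?D\<close> by simp
  qed
  moreover have "dist u v < 2 * ?D" for u v :: 'a
    using D[of u v] \<open>0 < ?D\<close> by simp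
  ultimately show ?thesis
    using \<open>0 < ?D\<close> True by (intro exI[of _ "2 * ?D"]) auto
next
  case False
  then have "ball x \<rho> \<noteq> UNIV" for x :: 'a and \<rho>
    using bounded_ball[of x \<rho>] by metis
  then show ?thesis
    using False by (intro exI[of _ 1]) simp
qed

theorem proposition3p8:
  assumes "complete (UNIV :: 'a::metric_space set)"
    and "doubling_space TYPE('a)"
    and "uniformly_perfect_space TYPE('a)"
    and "no_isolated_points TYPE('a)"
  shows "\<exists>(T :: nat set) \<pi> \<phi> (K :: nat \<Rightarrow> 'a set).
           tree_with_reference_point T \<pi> \<phi> \<and> is_partition T \<pi> \<phi> K \<and> basic_framework T \<pi> \<phi> K"
proof -
  obtain \<gamma> where "1 < \<gamma>" and unif: "\<And>(x::'a) \<rho>. 0 < \<rho> \<Longrightarrow> ball x \<rho> \<noteq> UNIV \<Longrightarrow> ball x (\<gamma> * \<rho>) - ball x \<rho> \<noteq> {}"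
    using assms(3) unfolding uniformly_perfect_space_def by blast
  obtain a where "0 < a" and small: "\<And>x y :: 'a. bounded (UNIV :: 'a set) \<Longrightarrow> dist x y < a"
    and proper: "\<And>(x::'a) \<rho>. (bounded (UNIV :: 'a set) \<Longrightarrow> \<rho> \<le> a / 8) \<Longrightarrow> ball x \<rho> \<noteq> UNIV"
    using proper_ball_radius[OF assms(4)] by blast
  \<comment> \<open>Uniform perfectness speaks of proper balls only; \<open>proper\<close> turns
    this into a condition on the radius.\<close>
  have perfect: "\<exists>y. \<rho> \<le> dist x y \<and> dist x y < \<gamma> * \<rho>"
    if "0 < \<rho>" "bounded (UNIV :: 'a set) \<Longrightarrow> \<rho> \<le> a / 8" for x :: 'a and \<rho>
    using unif[OF that(1) proper[OF that(2)], of x] by (auto simp: not_less)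
  obtain T :: "(int \<times> 'a) set" and \<pi> \<phi> sc r A c where
    tree: "net_tree T \<pi> \<phi> fst snd (bounded (UNIV :: 'a set)) sc r A c \<gamma>"
    using net_tree_exists[OF assms(1,2,4) \<open>1 < \<gamma>\<close> \<open>0 < a\<close> perfect small] by blast
  define h g where "h = to_nat_on T" and "g = from_nat_into T"
  have "g (h z) = z" if "z \<in> T" for z
    using that net_tree.countable_T[OF tree] by (simp add: h_def g_def)
  then have "net_tree (h ` T) (h \<circ> \<pi> \<circ> g) (h \<phi>) (fst \<circ> g) (snd \<circ> g) (bounded (UNIV :: 'a set)) sc r A c \<gamma>"
    by (rule net_tree_transport[OF tree])
  then show ?thesis
    using net_tree.tree net_tree.partition net_tree.framework by (intro exI conjI)
qed

end
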